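(* Let \[ {\bf D}^2=\inf_{0\ne f\in\mathcal{B}_2(\pi)}\frac{\|f\|_{L^2(\mathrm{d}\mu)}^2}{\|f\|_2^2}. \] Then ${\bf D}^2=1-\frac{1}{2\pi^2\theta^2}=0.3244\ldots$, where $0<\theta<\frac12$ is the unique solution of $(\pi\theta)\tan(\pi\theta)=1$ ($\theta=0.27385\ldots$). Moreover, up to multiplication by a non-zero complex constant, there is a unique $f\in\mathcal{B}_2(\pi)$ with $\|f\|_{L^2(\mathrm{d}\mu)}/\|f\|_2={\bf D}$, namely \[ f(z)=\frac{\sin\pi(z+\theta)}{\pi(z+\theta)}+\frac{\sin\pi(z-\theta)}{\pi(z-\theta)}. \]
   Context: $\mathcal{B}_2(\pi)$ is the Paley--Wiener space of entire functions $f$ of exponential type at most $\pi$ (i.e. for every $\varepsilon>0$ there is $C_\varepsilon$ with $|f(z)|\le C_\varepsilon e^{(\pi+\varepsilon)|z|}$) with $\|f\|_2=(\int_{\mathbb{R}}|f(x)|^2\,\mathrm{d}x)^{1/2}<\infty$. The measure $\mu$ on $\mathbb{R}$ is $\mathrm{d}\mu(x)=\big\{1-(\frac{\sin\pi x}{\pi x})^2\big\}\mathrm{d}x$, and $\|f\|_{L^2(\mathrm{d}\mu)}=(\int_{\mathbb{R}}|f(x)|^2\,\mathrm{d}\mu(x))^{1/2}$. *)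

theory Defs
  imports "HOL-Analysis.Analysis"
begin

(* The value 1 at 0 removes the singularity of the quotient (x / 0 = 0 in HOL), so that the
   function is entire on the complex numbers. *)
definition sinc_pi :: "'a::{real_normed_field,banach} \<Rightarrow> 'a" where
  "sinc_pi z = (if z = 0 then 1 else sin (of_real pi * z) / (of_real pi * z))"

definition exp_type_at_most :: "real \<Rightarrow> (complex \<Rightarrow> complex) \<Rightarrow> bool" where
  "exp_type_at_most \<tau> f \<longleftrightarrow>
     (\<forall>\<epsilon>>0. \<exists>C::real. \<forall>z. cmod (f z) \<le> C * exp ((\<tau> + \<epsilon>) * cmod z))"

definition paley_wiener :: "real \<Rightarrow> (complex \<Rightarrow> complex) set" where
  "paley_wiener \<tau> =
     {f. f holomorphic_on UNIV \<and> exp_type_at_most \<tau> f \<and>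
         integrable lborel (\<lambda>x::real. (cmod (f (of_real x)))\<^sup>2)}"

definition L2_norm_real_line :: "real measure \<Rightarrow> (complex \<Rightarrow> complex) \<Rightarrow> real" where
  "L2_norm_real_line M f = sqrt (LINT x|M. (cmod (f (of_real x)))\<^sup>2)"

(* ennreal truncates negative arguments to 0; no truncation occurs here as |sinc_pi x| <= 1. *)
definition pair_corr_measure :: "real measure" where
  "pair_corr_measure = density lborel (\<lambda>x. ennreal (1 - (sinc_pi x)\<^sup>2))"

definition D_sq :: real where
  "D_sq = (INF f \<in> paley_wiener pi - {\<lambda>z. 0}.
             (L2_norm_real_line pair_corr_measure f)\<^sup>2 / (L2_norm_real_line lborel f)\<^sup>2)"

end

theory Submission
  imports Defs "HOL-Complex_Analysis.Complex_Analysis" "HOL-Real_Asymp.Real_Asymp"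
    "HOL-Probability.Sinc_Integral"
begin

text \<open>Everything rests on one quadrature formula: an entire function \<open>g\<close> of exponential type at most
  \<open>2\<pi>\<close> that is integrable on the real line satisfies \<open>\<Sum>\<^sub>n g(a + n) = \<integral> g\<close> for every \<open>a\<close>.
  Its periodization is entire and \<open>O(exp (2\<pi>|Im z|))\<close> by Phragmen--Lindeloef, hence a trigonometric
  polynomial of degree one, whose extreme coefficients vanish by dilating \<open>g\<close>.

  Put \<open>a\<^sub>n = f(n + 1/2)\<close> and \<open>b\<^sub>n = sinc(n + 1/2)\<close>. Quadrature applied to \<open>f(z) cnj (f(cnj z))\<close>,
  to \<open>f(z) sinc(z)\<close> and, on the half-integer lattice, to \<open>f(z) cnj (f(cnj z)) sinc(z)\<^sup>2\<close> gives
  \<open>\<integral>|f|\<^sup>2 = \<Sum>|a\<^sub>n|\<^sup>2\<close>, \<open>f(0) = \<Sum> a\<^sub>n b\<^sub>n\<close> and \<open>2 \<integral>|f|\<^sup>2 sinc\<^sup>2 = |f(0)|\<^sup>2 + \<Sum> b\<^sub>n\<^sup>2 |a\<^sub>n|\<^sup>2\<close>.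
  So the problem is to find the top eigenvalue of a diagonal form perturbed by a form of rank one; its
  secular equation is \<open>\<pi>\<theta> tan (\<pi>\<theta>) = 1\<close>, and the eigenvector is the sample sequence of the extremal
  function.\<close>

section \<open>Exponential type and the Phragmen--Lindeloef principle\<close>

text \<open>The functions |f|^2 and f sinc have type exactly 2\<pi>, which is critical for unit
  spacing: the bound exp (2\<pi>|Im z|) still admits the frequencies 1 and -1 in the periodization,
  and only a limit of strictly smaller types removes them. A further obstacle is that summing
  translates off the real line needs L1 control on every horizontal line, while integrability is
  given on the real line alone. Phragmen-Lindeloef is therefore applied not to g but to integrals of
  its translates against bounded weights.

  Half-integers are chosen because sinc vanishes at every integer except 0, whereas \<open>b\<close>
  satisfies b_n^2 = 1/(\<pi>^2 (n + 1/2)^2). The product |f|^2 sinc^2 has type 4\<pi> and needs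
  spacing 1/2; the integer points of that finer lattice leave only |f(0)|^2, which has rank one
  since f(0) is linear in the samples. Put \<lambda> = 1/(\<pi>\<theta>)^2. Then \<theta> < 1/2
  places \<lambda> above every b_n^2, and the secular equation needs no series evaluation: it is the
  formula for f(0), read for the candidate extremal function.\<close>

lemma exp_type_at_mostE:
  assumes "exp_type_at_most \<tau> f" "\<epsilon> > 0"
  obtains C where "C \<ge> 0" "\<And>z. cmod (f z) \<le> C * exp ((\<tau> + \<epsilon>) * cmod z)"
proof -
  obtain C where C: "\<And>z. cmod (f z) \<le> C * exp ((\<tau> + \<epsilon>) * cmod z)"
    using assms unfolding exp_type_at_most_def by blast
  have "0 \<le> C * exp ((\<tau> + \<epsilon>) * cmod 0)"
    using C[of 0] by (rule order_trans[OF norm_ge_zero])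
  then have "C \<ge> 0" by simp
  with C show ?thesis using that by blast
qed

section \<open>Stability of exponential type under algebraic operations, translations, dilations and
  rotations\<close>

lemma exp_type_at_most_mult:
  assumes "exp_type_at_most \<sigma> f" "exp_type_at_most \<tau> g"
  shows "exp_type_at_most (\<sigma> + \<tau>) (\<lambda>z. f z * g z)"
  unfolding exp_type_at_most_def
proof (intro allI impI)
  fix \<epsilon> :: real assume "\<epsilon> > 0"
  then have e: "\<epsilon> / 2 > 0" by simp
  obtain B where B: "B \<ge> 0" "\<And>z. cmod (f z) \<le> B * exp ((\<sigma> + \<epsilon> / 2) * cmod z)"
    using exp_type_at_mostE[OF assms(1) e] by blast
  obtain C where C: "C \<ge> 0" "\<And>z. cmod (g z) \<le> C * exp ((\<tau> + \<epsilon> / 2) * cmod z)"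
    using exp_type_at_mostE[OF assms(2) e] by blast
  have "cmod (f z * g z) \<le> (B * C) * exp ((\<sigma> + \<tau> + \<epsilon>) * cmod z)" for z
  proof -
    have "cmod (f z * g z) \<le> (B * exp ((\<sigma> + \<epsilon> / 2) * cmod z)) * (C * exp ((\<tau> + \<epsilon> / 2) * cmod z))"
      unfolding norm_mult by (intro mult_mono B C) (simp_all add: B)
    also have "\<dots> = (B * C) * exp ((\<sigma> + \<epsilon> / 2) * cmod z + (\<tau> + \<epsilon> / 2) * cmod z)"
      by (simp add: exp_add)
    also have "(\<sigma> + \<epsilon> / 2) * cmod z + (\<tau> + \<epsilon> / 2) * cmod z = (\<sigma> + \<tau> + \<epsilon>) * cmod z"
      by (simp add: field_simps)
    finally show ?thesis .
  qed
  then show "\<exists>C. \<forall>z. cmod (f z * g z) \<le> C * exp ((\<sigma> + \<tau> + \<epsilon>) * cmod z)" by blast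
qed

lemma exp_type_at_most_add:
  assumes "exp_type_at_most \<tau> f" "exp_type_at_most \<tau> g"
  shows "exp_type_at_most \<tau> (\<lambda>z. f z + g z)"
  unfolding exp_type_at_most_def
proof (intro allI impI)
  fix \<epsilon> :: real assume e: "\<epsilon> > 0"
  obtain B where B: "\<And>z. cmod (f z) \<le> B * exp ((\<tau> + \<epsilon>) * cmod z)"
    using exp_type_at_mostE[OF assms(1) e] by blast
  obtain C where C: "\<And>z. cmod (g z) \<le> C * exp ((\<tau> + \<epsilon>) * cmod z)"
    using exp_type_at_mostE[OF assms(2) e] by blast
  have "cmod (f z + g z) \<le> (B + C) * exp ((\<tau> + \<epsilon>) * cmod z)" for z
    using norm_triangle_ineq[of "f z" "g z"] B[of z] C[of z] by (simp add: distrib_right)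
  then show "\<exists>C. \<forall>z. cmod (f z + g z) \<le> C * exp ((\<tau> + \<epsilon>) * cmod z)" by blast
qed

lemma exp_type_at_most_const: "exp_type_at_most 0 (\<lambda>z. c)"
  unfolding exp_type_at_most_def
proof (intro allI impI exI)
  fix \<epsilon> :: real and z assume "\<epsilon> > 0"
  then have "1 \<le> exp ((0 + \<epsilon>) * cmod z)" by simp
  then show "cmod c \<le> cmod c * exp ((0 + \<epsilon>) * cmod z)"
    using mult_left_mono[of 1 "exp ((0 + \<epsilon>) * cmod z)" "cmod c"] by simp
qed

lemma exp_type_at_most_cmult:
  assumes "exp_type_at_most \<tau> f"
  shows "exp_type_at_most \<tau> (\<lambda>z. c * f z)"
  using exp_type_at_most_mult[OF exp_type_at_most_const assms] by simp

lemma exp_type_at_most_shift: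
  assumes "exp_type_at_most \<tau> f" "\<tau> \<ge> 0"
  shows "exp_type_at_most \<tau> (\<lambda>z. f (z + a))"
  unfolding exp_type_at_most_def
proof (intro allI impI)
  fix \<epsilon> :: real assume e: "\<epsilon> > 0"
  obtain C where C: "C \<ge> 0" "\<And>z. cmod (f z) \<le> C * exp ((\<tau> + \<epsilon>) * cmod z)"
    using exp_type_at_mostE[OF assms(1) e] by blast
  have "cmod (f (z + a)) \<le> (C * exp ((\<tau> + \<epsilon>) * cmod a)) * exp ((\<tau> + \<epsilon>) * cmod z)" for z
  proof -
    have "(\<tau> + \<epsilon>) * cmod (z + a) \<le> (\<tau> + \<epsilon>) * (cmod z + cmod a)"
      using assms(2) e by (intro mult_left_mono norm_triangle_ineq) auto
    then have "C * exp ((\<tau> + \<epsilon>) * cmod (z + a)) \<le> C * exp ((\<tau> + \<epsilon>) * cmod a + (\<tau> + \<epsilon>) * cmod z)"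
      using C(1) by (intro mult_left_mono) (auto simp: algebra_simps)
    with C(2)[of "z + a"] show ?thesis by (simp add: exp_add)
  qed
  then show "\<exists>C. \<forall>z. cmod (f (z + a)) \<le> C * exp ((\<tau> + \<epsilon>) * cmod z)" by blast
qed

lemma exp_type_at_most_scale:
  assumes "exp_type_at_most \<tau> f" "r > 0"
  shows "exp_type_at_most (\<tau> * r) (\<lambda>z. f (of_real r * z))"
  unfolding exp_type_at_most_def
proof (intro allI impI)
  fix \<epsilon> :: real assume "\<epsilon> > 0"
  then have e: "\<epsilon> / r > 0" using assms by simp
  obtain C where C: "\<And>z. cmod (f z) \<le> C * exp ((\<tau> + \<epsilon> / r) * cmod z)"
    using exp_type_at_mostE[OF assms(1) e] by blast
  have "cmod (f (of_real r * z)) \<le> C * exp ((\<tau> * r + \<epsilon>) * cmod z)" for z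
  proof -
    have "(\<tau> + \<epsilon> / r) * cmod (of_real r * z) = (\<tau> * r + \<epsilon>) * cmod z"
      using assms(2) by (simp add: norm_mult field_simps)
    with C[of "of_real r * z"] show ?thesis by simp
  qed
  then show "\<exists>C. \<forall>z. cmod (f (of_real r * z)) \<le> C * exp ((\<tau> * r + \<epsilon>) * cmod z)" by blast
qed

lemma exp_type_at_most_rotate:
  assumes "exp_type_at_most \<tau> f" "cmod \<omega> = 1"
  shows "exp_type_at_most \<tau> (\<lambda>z. f (\<omega> * z))"
  unfolding exp_type_at_most_def
proof (intro allI impI)
  fix \<epsilon> :: real assume e: "\<epsilon> > 0"
  obtain C where C: "\<And>z. cmod (f z) \<le> C * exp ((\<tau> + \<epsilon>) * cmod z)"
    using exp_type_at_mostE[OF assms(1) e] by blast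
  show "\<exists>C. \<forall>z. cmod (f (\<omega> * z)) \<le> C * exp ((\<tau> + \<epsilon>) * cmod z)"
    using C[of "\<omega> * _"] assms(2) by (auto simp: norm_mult)
qed

lemma entire_compose:
  assumes "f holomorphic_on UNIV" "g holomorphic_on A"
  shows "(\<lambda>z. f (g z)) holomorphic_on A"
  using holomorphic_on_compose_gen[OF assms(2,1)] by (simp add: o_def)

text \<open>Maximum modulus on \<open>U \<inter> ball 0 R\<close>: a boundary point of this bounded
  set lies on \<open>frontier U\<close> or on the circle of radius R. As R is at least \<rho>, the
  circle falls under the bound near infinity.\<close>

lemma norm_le_on_unbounded_domain:
  assumes "open U" "F holomorphic_on U" "continuous_on (closure U) F"
    and bd: "\<And>z. z \<in> frontier U \<Longrightarrow> cmod (F z) \<le> M"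
    and inf: "\<And>z. z \<in> closure U \<Longrightarrow> cmod z \<ge> \<rho> \<Longrightarrow> cmod (F z) \<le> M"
    and z: "z \<in> U"
  shows "cmod (F z) \<le> M"
proof -
  define R where "R = max \<rho> (cmod z + 1)"
  have sub: "closure (U \<inter> ball 0 R) \<subseteq> closure U" by (intro closure_mono) auto
  show ?thesis
  proof (rule maximum_modulus_frontier[where f = F and \<xi> = z and S = "U \<inter> ball 0 R"])
    show "F holomorphic_on interior (U \<inter> ball 0 R)"
      using holomorphic_on_subset[OF assms(2)] interior_subset[of "U \<inter> ball 0 R"] by blast
    show "continuous_on (closure (U \<inter> ball 0 R)) F"
      using assms(3) sub by (rule continuous_on_subset)
    show "z \<in> U \<inter> ball 0 R" using z by (auto simp: R_def)
    fix w assume w: "w \<in> frontier (U \<inter> ball 0 R)"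
    have "R > 0" unfolding R_def using norm_ge_zero[of z] by linarith
    have "w \<in> closure U" using w sub unfolding frontier_def by auto
    moreover have "w \<in> frontier U \<or> w \<in> frontier (ball 0 R)"
      using w frontier_Int_subset by blast
    ultimately show "cmod (F w) \<le> M"
      using bd inf[of w] \<open>R > 0\<close> by (auto simp: R_def)
  qed (auto intro: bounded_subset[OF bounded_ball])
qed

text \<open>A quadrant has opening \<pi>/2, so the principle tolerates every order of growth below
  2. Order 1 is beaten by a damping factor exp (-\<delta> w^(3/2)), of order 3/2, where w is the
  variable turned so that the quadrant is symmetric about the positive axis; then \<delta> tends to
  0.\<close>

lemma norm_le_on_quadrant:
  assumes F: "F holomorphic_on UNIV"
    and growth: "\<And>z. cmod (F z) \<le> C * exp (c * cmod z)"
    and re: "\<And>t. t \<ge> 0 \<Longrightarrow> cmod (F (of_real t)) \<le> M"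
    and im: "\<And>t. t \<ge> 0 \<Longrightarrow> cmod (F (\<i> * of_real t)) \<le> M"
    and M: "M > 0" and c: "c \<ge> 0" and z: "Re z \<ge> 0" "Im z \<ge> 0"
  shows "cmod (F z) \<le> M"
proof -
  define U where "U = {z. 0 < Re z \<and> 0 < Im z}"
  \<comment> \<open>The factor 1 - \<i> turns the bisector of the quadrant onto the positive real
    axis. Adding 1 keeps w away from 0, so that its square root s is holomorphic near the closed
    quadrant; s^3 is the power w^(3/2).\<close>
  define w where "w = (\<lambda>z. (1 - \<i>) * z + 1)"
  define s where "s = (\<lambda>z. csqrt (w z))"
  have opU: "open U" unfolding U_def
    by (intro open_Collect_conj open_halfspace_Re_gt open_halfspace_Im_gt)
  have clU: "closure U \<subseteq> {z. 0 \<le> Re z \<and> 0 \<le> Im z}"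
    by (rule closure_minimal)
       (auto simp: U_def intro: closed_Collect_conj closed_halfspace_Re_ge closed_halfspace_Im_ge)
  have Rew: "Re (w z) > 0" if "0 \<le> Re z" "0 \<le> Im z" for z
    using that by (simp add: w_def)
  \<comment> \<open>The argument of w is at most \<pi>/4 in modulus, hence that of s at most
    \<pi>/8. The constant 1/5 is a rational bound for tan(\<pi>/8)^2 = 3 - 2 sqrt 2, small enough to
    keep Re (s^3) comparable to (Re s)^3.\<close>
  have s: "Re (s z) > 0" "5 * (Im (s z))\<^sup>2 \<le> (Re (s z))\<^sup>2" "(s z)\<^sup>2 = w z"
    if "0 \<le> Re z" "0 \<le> Im z" for z
  proof -
    show ww: "(s z)\<^sup>2 = w z" by (simp add: s_def)
    show pos: "Re (s z) > 0"
      unfolding s_def using Rew[OF that] by (simp add: add_nonneg_pos)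
    define p q where "p = (Re (s z))\<^sup>2" and "q = (Im (s z))\<^sup>2"
    have R: "Re (w z) = p - q" "(Im (w z))\<^sup>2 = 4 * p * q"
      unfolding ww[symmetric] by (simp_all add: p_def q_def power2_eq_square)
    have "\<bar>Im (w z)\<bar> \<le> \<bar>Re (w z)\<bar>" using that by (simp add: w_def)
    then have le: "4 * p * q \<le> (p - q)\<^sup>2" using R by (metis abs_le_square_iff)
    have "p - q > 0" using Rew[OF that] R by simp
    have "q \<ge> 0" "p > 0" using pos by (auto simp: p_def q_def)
    have "5 * q \<le> p"
    proof (rule ccontr)
      assume "\<not> 5 * q \<le> p"
      then have q: "q > p / 5" by simp
      have "(p - q)\<^sup>2 \<le> (4 / 5 * p)\<^sup>2"
        using \<open>p - q > 0\<close> q by (intro power_mono) auto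
      also have "\<dots> < 4 * p * (p / 5)" using \<open>p > 0\<close> by (simp add: power2_eq_square)
      also have "\<dots> \<le> 4 * p * q" using q \<open>p > 0\<close> by (intro mult_left_mono) auto
      finally show False using le by simp
    qed
    then show "5 * (Im (s z))\<^sup>2 \<le> (Re (s z))\<^sup>2" by (simp add: p_def q_def)
  qed
  have cube: "Re (s z ^ 3) \<ge> 2 / 5 * Re (s z) ^ 3" if "0 \<le> Re z" "0 \<le> Im z" for z
  proof -
    have "Re (s z ^ 3) = Re (s z) * ((Re (s z))\<^sup>2 - 3 * (Im (s z))\<^sup>2)"
      by (simp add: power3_eq_cube power2_eq_square algebra_simps)
    also have "\<dots> \<ge> Re (s z) * (2 / 5 * (Re (s z))\<^sup>2)"
      using s[OF that] by (intro mult_left_mono) auto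
    finally show ?thesis by (simp add: power3_eq_cube power2_eq_square)
  qed
  have zle: "cmod z \<le> 6 / 5 * (Re (s z))\<^sup>2 + 1" if "0 \<le> Re z" "0 \<le> Im z" for z
  proof -
    have "cmod (w z) = (cmod (s z))\<^sup>2" unfolding s(3)[OF that, symmetric] by (simp add: norm_power)
    also have "\<dots> = (Re (s z))\<^sup>2 + (Im (s z))\<^sup>2" by (simp add: cmod_power2)
    finally have 1: "cmod (w z) \<le> 6 / 5 * (Re (s z))\<^sup>2" using s(2)[OF that] by simp
    have "cmod (1 - \<i>) = sqrt 2" by (simp add: cmod_def)
    then have "cmod z \<le> cmod ((1 - \<i>) * z)"
      by (simp add: norm_mult mult_le_cancel_right1)
    also have "\<dots> = cmod (w z - 1)" by (simp add: w_def)
    also have "\<dots> \<le> cmod (w z) + 1" using norm_triangle_ineq4[of "w z" 1] by simp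
    finally show ?thesis using 1 by simp
  qed
  \<comment> \<open>In terms of a = Re (s z), the growth exponent of F is at most quadratic in a (by
    \<open>zle\<close>) and the damping exponent is cubic (by \<open>cube\<close>), so the product
    falls below M far out.\<close>
  have main: "cmod (F z * exp (- of_real \<delta> * s z ^ 3)) \<le> M" if \<delta>: "\<delta> > 0" and zU: "z \<in> U" for z \<delta>
  proof -
    have "((\<lambda>a. C * exp (c * (6 / 5 * a\<^sup>2 + 1) - \<delta> * (2 / 5 * a ^ 3))) \<longlongrightarrow> 0) at_top"
      using \<delta> by real_asymp
    then have "eventually (\<lambda>a. C * exp (c * (6 / 5 * a\<^sup>2 + 1) - \<delta> * (2 / 5 * a ^ 3)) < M) at_top"
      using M by (rule order_tendstoD)
    then obtain a0 where a0: "\<And>a. a \<ge> a0 \<Longrightarrow> C * exp (c * (6 / 5 * a\<^sup>2 + 1) - \<delta> * (2 / 5 * a ^ 3)) < M"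
      unfolding eventually_at_top_linorder by blast
    have C0: "C \<ge> 0" using order_trans[OF norm_ge_zero growth[of 0]] by simp
    have hol: "(\<lambda>z. F z * exp (- of_real \<delta> * s z ^ 3)) holomorphic_on {z. Re (w z) > 0}"
      unfolding s_def
      by (intro holomorphic_intros holomorphic_on_subset[OF F])
         (auto simp: w_def complex_nonpos_Reals_iff intro!: holomorphic_intros)
    have le1: "cmod (exp (- of_real \<delta> * s z ^ 3)) \<le> exp (- \<delta> * (2 / 5 * Re (s z) ^ 3))"
      if "0 \<le> Re z" "0 \<le> Im z" for z
      using cube[OF that] \<delta> by (simp add: mult_le_cancel_left)
    have le2: "exp (- \<delta> * (2 / 5 * Re (s z) ^ 3)) \<le> 1" if "0 \<le> Re z" "0 \<le> Im z" for z
      using \<delta> s(1)[OF that] by simp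
    show ?thesis
    proof (rule norm_le_on_unbounded_domain[OF opU _ _ _ _ zU, where \<rho> = "6 / 5 * a0\<^sup>2 + 2"])
      show "(\<lambda>z. F z * exp (- of_real \<delta> * s z ^ 3)) holomorphic_on U"
        by (rule holomorphic_on_subset[OF hol]) (auto simp: U_def intro: Rew)
      show "continuous_on (closure U) (\<lambda>z. F z * exp (- of_real \<delta> * s z ^ 3))"
        by (rule continuous_on_subset[OF holomorphic_on_imp_continuous_on[OF hol]])
           (use clU Rew in auto)
    next
      fix z assume "z \<in> frontier U"
      then have zc: "0 \<le> Re z" "0 \<le> Im z" and "z \<notin> U"
        using clU opU by (auto simp: frontier_def interior_open)
      then have "Re z = 0 \<or> Im z = 0" by (auto simp: U_def)
      then have "z = \<i> * of_real (Im z) \<or> z = of_real (Re z)"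
        by (auto simp: complex_eq_iff)
      then have "cmod (F z) \<le> M" using re[of "Re z"] im[of "Im z"] zc by auto
      moreover have "cmod (exp (- of_real \<delta> * s z ^ 3)) \<le> 1"
        using le1[OF zc] le2[OF zc] by simp
      ultimately have "cmod (F z) * cmod (exp (- of_real \<delta> * s z ^ 3)) \<le> M * 1"
        using M by (intro mult_mono) auto
      then show "cmod (F z * exp (- of_real \<delta> * s z ^ 3)) \<le> M" by (simp add: norm_mult)
    next
      fix z assume "z \<in> closure U" and big: "6 / 5 * a0\<^sup>2 + 2 \<le> cmod z"
      then have zc: "0 \<le> Re z" "0 \<le> Im z" using clU by auto
      have "a0\<^sup>2 \<le> (Re (s z))\<^sup>2" using zle[OF zc] big by simp
      then have "\<bar>a0\<bar> \<le> \<bar>Re (s z)\<bar>" by (simp add: abs_le_square_iff)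
      then have a: "a0 \<le> Re (s z)" using s(1)[OF zc] by simp
      have "cmod (F z * exp (- of_real \<delta> * s z ^ 3))
          \<le> (C * exp (c * (6 / 5 * (Re (s z))\<^sup>2 + 1))) * exp (- \<delta> * (2 / 5 * Re (s z) ^ 3))"
        unfolding norm_mult
      proof (intro mult_mono le1 zc)
        have "C * exp (c * cmod z) \<le> C * exp (c * (6 / 5 * (Re (s z))\<^sup>2 + 1))"
          using zle[OF zc] C0 c by (intro mult_left_mono) (auto intro!: mult_left_mono)
        then show "cmod (F z) \<le> C * exp (c * (6 / 5 * (Re (s z))\<^sup>2 + 1))"
          using growth[of z] by simp
      qed (use C0 in auto)
      also have "\<dots> = C * exp (c * (6 / 5 * (Re (s z))\<^sup>2 + 1) - \<delta> * (2 / 5 * Re (s z) ^ 3))"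
        unfolding mult.assoc exp_add[symmetric] by simp
      also have "\<dots> \<le> M" using a0[OF a] by simp
      finally show "cmod (F z * exp (- of_real \<delta> * s z ^ 3)) \<le> M" .
    qed
  qed
  show ?thesis
  proof (cases "z \<in> U")
    case True
    have "((\<lambda>\<delta>. cmod (F z * exp (- of_real \<delta> * s z ^ 3))) \<longlongrightarrow> cmod (F z * exp (- of_real 0 * s z ^ 3))) (at_right 0)"
      by (intro tendsto_intros)
    moreover have "eventually (\<lambda>\<delta>. cmod (F z * exp (- of_real \<delta> * s z ^ 3)) \<le> M) (at_right 0)"
      using main[OF _ True] by (auto simp: eventually_at_filter)
    ultimately have "cmod (F z * exp (- of_real 0 * s z ^ 3)) \<le> M"
      by (rule tendsto_upperbound) simp
    then show ?thesis by simp
  next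
    case False
    then have "Re z = 0 \<or> Im z = 0" using z by (auto simp: U_def)
    then have "z = \<i> * of_real (Im z) \<or> z = of_real (Re z)"
      by (auto simp: complex_eq_iff)
    then show ?thesis using re[of "Re z"] im[of "Im z"] z by auto
  qed
qed

text \<open>Here F is already known to be bounded, so a mild damping suffices: 1 - \<i>\<delta>z has
  real part at least 1 on the closed half-plane and grows linearly. Dividing by it preserves the
  bound M on the axis and forces decay at infinity; letting \<delta> tend to 0 replaces the crude B
  by M.\<close>

lemma norm_le_on_half_plane:
  assumes F: "F holomorphic_on UNIV"
    and bdd: "\<And>z. Im z \<ge> 0 \<Longrightarrow> cmod (F z) \<le> B"
    and re: "\<And>t::real. cmod (F (of_real t)) \<le> M"
    and M: "M > 0" and z: "Im z \<ge> 0"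
  shows "cmod (F z) \<le> M"
proof (cases "Im z > 0")
  case False
  then have "z = of_real (Re z)" using z by (simp add: complex_eq_iff)
  then show ?thesis using re[of "Re z"] by simp
next
  case True
  define U where "U = {z. 0 < Im z}"
  have opU: "open U" unfolding U_def by (intro open_halfspace_Im_gt)
  have clU: "closure U \<subseteq> {z. 0 \<le> Im z}"
    by (rule closure_minimal) (auto simp: U_def intro: closed_halfspace_Im_ge)
  \<comment> \<open>Beyond the radius (B/M + 1)/\<delta> the denominator has modulus at least
    \<delta>|z| - 1, hence at least B/M.\<close>
  have main: "cmod (F z / (1 - \<i> * of_real \<delta> * z)) \<le> M" if \<delta>: "\<delta> > 0" for \<delta>
  proof (rule norm_le_on_unbounded_domain[OF opU, where F = "\<lambda>z. F z / (1 - \<i> * of_real \<delta> * z)" and z = z and \<rho> = "(B / M + 1) / \<delta>"])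
    have Re1: "Re (1 - \<i> * of_real \<delta> * z) \<ge> 1" if "Im z \<ge> 0" for z
      using \<delta> that by simp
    have nz: "1 - \<i> * of_real \<delta> * z \<noteq> 0" if "Im z \<ge> 0" for z
      using Re1[OF that] by (metis not_one_le_zero zero_complex.sel(1))
    have ge1: "cmod (1 - \<i> * of_real \<delta> * z) \<ge> 1" if "Im z \<ge> 0" for z
      using Re1[OF that] complex_Re_le_cmod order_trans by blast
    show "(\<lambda>z. F z / (1 - \<i> * of_real \<delta> * z)) holomorphic_on U"
      by (intro holomorphic_intros holomorphic_on_subset[OF F]) (use nz in \<open>auto simp: U_def\<close>)
    show "continuous_on (closure U) (\<lambda>z. F z / (1 - \<i> * of_real \<delta> * z))"
      by (intro continuous_intros continuous_on_subset[OF holomorphic_on_imp_continuous_on[OF F]])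
         (use nz clU in auto)
    show "z \<in> U" using True by (simp add: U_def)
    fix z assume "z \<in> frontier U"
    then have zc: "0 \<le> Im z" and "z \<notin> U"
      using clU opU by (auto simp: frontier_def interior_open)
    then have "z = of_real (Re z)" by (simp add: U_def complex_eq_iff)
    then have "cmod (F z) \<le> M" using re[of "Re z"] by simp
    then have "cmod (F z) / cmod (1 - \<i> * of_real \<delta> * z) \<le> M / 1"
      using ge1[OF zc] M by (intro frac_le) auto
    then show "cmod (F z / (1 - \<i> * of_real \<delta> * z)) \<le> M" by (simp add: norm_divide)
  next
    fix z assume "z \<in> closure U" and big: "(B / M + 1) / \<delta> \<le> cmod z"
    then have zc: "0 \<le> Im z" using clU by auto
    have nz: "cmod (1 - \<i> * of_real \<delta> * z) > 0"
    proof -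
      have "Re (1 - \<i> * of_real \<delta> * z) > 0" using \<delta> zc by (simp add: add_pos_nonneg)
      then show ?thesis using complex_Re_le_cmod less_le_trans by blast
    qed
    have "B / M + 1 \<le> \<delta> * cmod z" using big \<delta> by (simp add: field_simps)
    also have "\<dots> = cmod (\<i> * of_real \<delta> * z)" using \<delta> by (simp add: norm_mult)
    also have "\<dots> \<le> 1 + cmod (1 - \<i> * of_real \<delta> * z)"
      using norm_triangle_ineq2[of "\<i> * of_real \<delta> * z" 1] by (simp add: norm_minus_commute)
    finally have "B / M \<le> cmod (1 - \<i> * of_real \<delta> * z)" by simp
    then have "B \<le> M * cmod (1 - \<i> * of_real \<delta> * z)" using M by (simp add: field_simps)
    then have "cmod (F z) \<le> M * cmod (1 - \<i> * of_real \<delta> * z)" using bdd[OF zc] by simp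
    then show "cmod (F z / (1 - \<i> * of_real \<delta> * z)) \<le> M"
      using nz by (simp add: norm_divide field_simps)
  qed
  have "((\<lambda>\<delta>. cmod (F z / (1 - \<i> * of_real \<delta> * z))) \<longlongrightarrow> cmod (F z / (1 - \<i> * of_real 0 * z))) (at_right 0)"
    by (intro tendsto_intros) auto
  moreover have "eventually (\<lambda>\<delta>. cmod (F z / (1 - \<i> * of_real \<delta> * z)) \<le> M) (at_right 0)"
    using main by (auto simp: eventually_at_filter)
  ultimately have "cmod (F z / (1 - \<i> * of_real 0 * z)) \<le> M"
    by (rule tendsto_upperbound) simp
  then show ?thesis by simp
qed

text \<open>The factor exp (\<i>(\<tau> + \<epsilon>)z) has modulus exp (-(\<tau> + \<epsilon>) Im
  z): it is harmless on the real axis and exactly cancels the type bound on the positive imaginary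
  axis. The two quadrants then give some bound B on the half-plane, the half-plane principle
  improves B to M, and \<epsilon> tends to 0.\<close>

lemma phragmen_lindelof_upper:
  assumes H: "H holomorphic_on UNIV" and type: "exp_type_at_most \<tau> H" and "\<tau> \<ge> 0"
    and re: "\<And>t::real. cmod (H (of_real t)) \<le> M" and M: "M > 0" and z: "Im z \<ge> 0"
  shows "cmod (H z) \<le> M * exp (\<tau> * Im z)"
proof -
  have main: "cmod (H z) \<le> M * exp ((\<tau> + \<epsilon>) * Im z)" if e: "\<epsilon> > 0" for \<epsilon>
  proof -
    obtain C where C: "C \<ge> 0" "\<And>z. cmod (H z) \<le> C * exp ((\<tau> + \<epsilon>) * cmod z)"
      using exp_type_at_mostE[OF type e] by blast
    define F where "F = (\<lambda>z. H z * exp (\<i> * of_real (\<tau> + \<epsilon>) * z))"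
    have holF: "F holomorphic_on UNIV" unfolding F_def by (intro holomorphic_intros H)
    have nF: "cmod (F z) = cmod (H z) * exp (- ((\<tau> + \<epsilon>) * Im z))" for z
      by (simp add: F_def norm_mult algebra_simps)
    have grow: "cmod (F z) \<le> C * exp (2 * (\<tau> + \<epsilon>) * cmod z)" for z
    proof -
      have "- ((\<tau> + \<epsilon>) * Im z) = (\<tau> + \<epsilon>) * (- Im z)" by simp
      also have "\<dots> \<le> (\<tau> + \<epsilon>) * cmod z"
        using abs_Im_le_cmod[of z] assms(3) e by (intro mult_left_mono) auto
      finally have "exp (- ((\<tau> + \<epsilon>) * Im z)) \<le> exp ((\<tau> + \<epsilon>) * cmod z)"
        by (simp add: algebra_simps)
      then have "cmod (F z) \<le> (C * exp ((\<tau> + \<epsilon>) * cmod z)) * exp ((\<tau> + \<epsilon>) * cmod z)"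
        unfolding nF using C by (intro mult_mono) auto
      also have "\<dots> = C * exp (2 * (\<tau> + \<epsilon>) * cmod z)"
        by (simp flip: exp_add add: algebra_simps)
      finally show ?thesis .
    qed
    define B where "B = max M C"
    have B: "B > 0" "M \<le> B" "C \<le> B" using M by (auto simp: B_def)
    have reF: "cmod (F (of_real t)) \<le> M" for t :: real using re[of t] by (simp add: nF)
    have imF: "cmod (F (\<i> * of_real t)) \<le> B" if "t \<ge> 0" for t
    proof -
      have "cmod (F (\<i> * of_real t)) \<le> C * exp ((\<tau> + \<epsilon>) * t) * exp (- ((\<tau> + \<epsilon>) * t))"
        using C(2)[of "\<i> * of_real t"] that by (simp add: nF norm_mult)
      also have "\<dots> = C" by (simp add: exp_minus)
      finally show ?thesis using B by simp
    qed
    have c: "0 \<le> 2 * (\<tau> + \<epsilon>)" using assms(3) e by simp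
    have bdd: "cmod (F z) \<le> B" if "Im z \<ge> 0" for z
    proof (cases "Re z \<ge> 0")
      case True
      show ?thesis
        by (rule norm_le_on_quadrant[OF holF grow _ imF B(1) c True that])
           (use reF B in \<open>auto intro: order_trans\<close>)
    next
      case False
      \<comment> \<open>The second quadrant is \<i> times the first; after this rotation the two
        boundary rays are the positive imaginary and the negative real axis.\<close>
      have "cmod (F (\<i> * (- \<i> * z))) \<le> B"
      proof (rule norm_le_on_quadrant[where F = "\<lambda>z. F (\<i> * z)" and C = C])
        show "(\<lambda>z. F (\<i> * z)) holomorphic_on UNIV"
          by (intro entire_compose[OF holF] holomorphic_intros)
        show "cmod (F (\<i> * z)) \<le> C * exp (2 * (\<tau> + \<epsilon>) * cmod z)" for z
          using grow[of "\<i> * z"] by (simp add: norm_mult)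
        show "cmod (F (\<i> * (\<i> * of_real t))) \<le> B" for t
          using reF[of "- t"] B by (simp flip: mult.assoc)
      qed (use imF B c False that in auto)
      then show ?thesis by (simp flip: mult.assoc)
    qed
    have "cmod (F z) \<le> M" by (rule norm_le_on_half_plane[OF holF bdd reF M z])
    then have "cmod (H z) / exp ((\<tau> + \<epsilon>) * Im z) \<le> M"
      by (simp add: nF exp_minus divide_inverse)
    then show ?thesis by (simp add: pos_divide_le_eq)
  qed
  have "((\<lambda>\<epsilon>. M * exp ((\<tau> + \<epsilon>) * Im z)) \<longlongrightarrow> M * exp ((\<tau> + 0) * Im z)) (at_right 0)"
    by (intro tendsto_intros)
  moreover have "eventually (\<lambda>\<epsilon>. cmod (H z) \<le> M * exp ((\<tau> + \<epsilon>) * Im z)) (at_right 0)"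
    using main by (auto simp: eventually_at_filter)
  ultimately have "cmod (H z) \<le> M * exp ((\<tau> + 0) * Im z)"
    by (rule tendsto_lowerbound) simp
  then show ?thesis by simp
qed

text \<open>The lower half-plane follows by the reflection z to -z. The slack \<eta> serves to
  include M = 0, the case by which a function vanishing on the real line is shown to vanish
  everywhere.\<close>

theorem phragmen_lindelof_exp_type:
  assumes H: "H holomorphic_on UNIV" and type: "exp_type_at_most \<tau> H" and "\<tau> \<ge> 0"
    and re: "\<And>t::real. cmod (H (of_real t)) \<le> M"
  shows "cmod (H z) \<le> M * exp (\<tau> * \<bar>Im z\<bar>)"
proof -
  have main: "cmod (H z) \<le> (M + \<eta>) * exp (\<tau> * \<bar>Im z\<bar>)" if "\<eta> > 0" for \<eta>
  proof -
    have "M \<ge> 0" using re[of 0] norm_ge_zero order_trans by blast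
    then have M: "M + \<eta> > 0" using that by simp
    have re': "cmod (H (of_real t)) \<le> M + \<eta>" for t :: real using re[of t] that by simp
    show ?thesis
    proof (cases "Im z \<ge> 0")
      case True
      then show ?thesis using phragmen_lindelof_upper[OF assms(1-3) re' M] by simp
    next
      case False
      have "(\<lambda>z. H (- z)) holomorphic_on UNIV"
        by (intro entire_compose[OF H] holomorphic_intros)
      moreover have "exp_type_at_most \<tau> (\<lambda>z. H (- z))"
        using exp_type_at_most_rotate[OF type, of "-1"] by simp
      ultimately have "cmod (H (- (- z))) \<le> (M + \<eta>) * exp (\<tau> * Im (- z))"
        by (rule phragmen_lindelof_upper) (use assms(3) M False re'[of "- _"] in auto)
      then show ?thesis using False by simp
    qed
  qed
  have "((\<lambda>\<eta>. (M + \<eta>) * exp (\<tau> * \<bar>Im z\<bar>)) \<longlongrightarrow> (M + 0) * exp (\<tau> * \<bar>Im z\<bar>)) (at_right 0)"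
    by (intro tendsto_intros)
  moreover have "eventually (\<lambda>\<eta>. cmod (H z) \<le> (M + \<eta>) * exp (\<tau> * \<bar>Im z\<bar>)) (at_right 0)"
    using main by (auto simp: eventually_at_filter)
  ultimately have "cmod (H z) \<le> (M + 0) * exp (\<tau> * \<bar>Im z\<bar>)"
    by (rule tendsto_lowerbound) simp
  then show ?thesis by simp
qed

section \<open>Integrable entire functions of exponential type on horizontal lines\<close>

locale L1_exp_type =
  fixes g :: "complex \<Rightarrow> complex" and \<tau> :: real
  assumes hol: "g holomorphic_on UNIV"
    and type: "exp_type_at_most \<tau> g"
    and \<tau>: "\<tau> \<ge> 0"
    and int: "integrable lborel (\<lambda>x::real. g (of_real x))"
begin

definition L1_norm :: real where "L1_norm = (LINT x|lborel. cmod (g (of_real x)))"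

lemma cont [continuous_intros]: "continuous_on S f \<Longrightarrow> continuous_on S (\<lambda>x. g (f x))"
  using continuous_on_compose2[OF holomorphic_on_imp_continuous_on[OF hol], of S f] by auto

lemma cont_deriv [continuous_intros]: "continuous_on S f \<Longrightarrow> continuous_on S (\<lambda>x. deriv g (f x))"
  using continuous_on_compose2[OF holomorphic_on_imp_continuous_on[OF holomorphic_deriv[OF hol]], of S f]
  by auto

lemma deriv_g: "(g has_field_derivative deriv g z) (at z within S)"
  using hol by (metis UNIV_I holomorphic_derivI open_UNIV has_field_derivative_at_within)

text \<open>As a function of z the integral is entire, and of type \<tau> because translations by
  bounded t change only the constant. On the real line it is at most the L1 norm of g by translation
  invariance, so Phragmen-Lindeloef applies. The bounds are uniform in a, b and u, which is what
  duality and the passage to long intervals require.\<close>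

lemma norm_integral_line_le:
  assumes u: "continuous_on {a..b} u" "\<And>t. t \<in> {a..b} \<Longrightarrow> cmod (u t) \<le> 1"
  shows "cmod (integral {a..b} (\<lambda>t. u t * g (z + of_real t))) \<le> L1_norm * exp (\<tau> * \<bar>Im z\<bar>)"
    and "cmod (integral {a..b} (\<lambda>t. u t * deriv g (z + of_real t))) \<le> L1_norm * exp (\<tau> * (\<bar>Im z\<bar> + 1))"
proof -
  define H where "H = (\<lambda>z. integral (cbox a b) (\<lambda>t. u t * g (z + of_real t)))"
  have "continuous_on (cbox a b) u" using u(1) by simp
  then have [continuous_intros]: "continuous_on (UNIV \<times> cbox a b) (\<lambda>p::complex \<times> real. u (snd p))"
    by (rule continuous_on_compose2) (auto intro!: continuous_intros)
  have dH: "(H has_field_derivative integral (cbox a b) (\<lambda>t. u t * deriv g (z + of_real t))) (at z)" for z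
    unfolding H_def
  proof (rule leibniz_rule_field_derivative[where U = UNIV])
    show "((\<lambda>z. u t * g (z + of_real t)) has_field_derivative u t * deriv g (z + of_real t)) (at z within UNIV)"
      for z t
      by (auto intro!: derivative_eq_intros DERIV_chain2[OF deriv_g])
    show "(\<lambda>t. u t * g (z + of_real t)) integrable_on cbox a b" for z
      using u by (intro integrable_continuous continuous_intros) auto
    show "continuous_on (UNIV \<times> cbox a b) (\<lambda>(z, t). u t * deriv g (z + of_real t))"
      unfolding case_prod_unfold by (intro continuous_intros)
  qed auto
  have holH: "H holomorphic_on UNIV"
    using dH by (auto simp: holomorphic_on_def field_differentiable_def)
  have typeH: "exp_type_at_most \<tau> H"
    unfolding exp_type_at_most_def
  proof (intro allI impI)
    fix \<epsilon> :: real assume e: "\<epsilon> > 0"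
    obtain C where C: "C \<ge> 0" "\<And>z. cmod (g z) \<le> C * exp ((\<tau> + \<epsilon>) * cmod z)"
      using exp_type_at_mostE[OF type e] by blast
    define r where "r = \<bar>a\<bar> + \<bar>b\<bar>"
    define K where "K = C * exp ((\<tau> + \<epsilon>) * r)"
    have "cmod (H z) \<le> (K * measure lborel (cbox a b)) * exp ((\<tau> + \<epsilon>) * cmod z)" for z
    proof -
      have "cmod (H z) \<le> (K * exp ((\<tau> + \<epsilon>) * cmod z)) * measure lborel (cbox a b)"
      proof (rule has_integral_bound)
        show "((\<lambda>t. u t * g (z + of_real t)) has_integral H z) (cbox a b)"
          unfolding H_def using u by (intro integrable_integral integrable_continuous continuous_intros) auto
        fix t assume t: "t \<in> cbox a b"
        have "cmod (z + of_real t) \<le> cmod z + r"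
          using norm_triangle_ineq[of z "of_real t"] t by (auto simp: r_def)
        then have "C * exp ((\<tau> + \<epsilon>) * cmod (z + of_real t)) \<le> C * exp ((\<tau> + \<epsilon>) * (cmod z + r))"
          using C \<tau> e by (intro mult_left_mono) (auto intro!: mult_left_mono)
        also have "\<dots> = K * exp ((\<tau> + \<epsilon>) * cmod z)" by (simp add: K_def distrib_left exp_add)
        finally have "cmod (g (z + of_real t)) \<le> K * exp ((\<tau> + \<epsilon>) * cmod z)"
          using C(2)[of "z + of_real t"] by simp
        then have "cmod (u t) * cmod (g (z + of_real t)) \<le> 1 * (K * exp ((\<tau> + \<epsilon>) * cmod z))"
          using u(2)[of t] t by (intro mult_mono) auto
        then show "cmod (u t * g (z + of_real t)) \<le> K * exp ((\<tau> + \<epsilon>) * cmod z)"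
          by (simp add: norm_mult)
      qed (use C in \<open>auto simp: K_def\<close>)
      then show ?thesis by (simp add: mult_ac)
    qed
    then show "\<exists>C. \<forall>z. cmod (H z) \<le> C * exp ((\<tau> + \<epsilon>) * cmod z)" by blast
  qed
  have reH: "cmod (H (of_real x)) \<le> L1_norm" for x :: real
  proof -
    have i: "integrable lborel (\<lambda>t. cmod (g (of_real x + of_real t)))"
      using integrable_norm[OF lborel_integrable_real_affine[OF int, of 1 x]] by simp
    have L1_norm: "L1_norm = (LINT t|lborel. cmod (g (of_real x + of_real t)))"
      unfolding L1_norm_def
      by (subst lborel_integral_real_affine[where c = 1 and t = x]) auto
    have "cmod (H (of_real x)) \<le> integral (cbox a b) (\<lambda>t. cmod (g (of_real x + of_real t)))"
      unfolding H_def
    proof (rule integral_norm_bound_integral)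
      show "(\<lambda>t. u t * g (of_real x + of_real t)) integrable_on cbox a b"
        using u by (intro integrable_continuous continuous_intros) auto
      show "(\<lambda>t. cmod (g (of_real x + of_real t))) integrable_on cbox a b"
        by (intro integrable_continuous continuous_intros)
      fix t assume "t \<in> cbox a b"
      then have "cmod (u t) * cmod (g (of_real x + of_real t)) \<le> 1 * cmod (g (of_real x + of_real t))"
        using u(2)[of t] by (intro mult_mono) auto
      then show "cmod (u t * g (of_real x + of_real t)) \<le> cmod (g (of_real x + of_real t))"
        by (simp add: norm_mult)
    qed
    also have "\<dots> \<le> integral UNIV (\<lambda>t. cmod (g (of_real x + of_real t)))"
      by (intro integral_subset_le integrable_continuous continuous_intros integrable_on_lborel[OF i]) auto
    also have "\<dots> = L1_norm" unfolding L1_norm using has_integral_integral_lborel[OF i] by (rule integral_unique)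
    finally show ?thesis .
  qed
  have bound: "cmod (H z) \<le> L1_norm * exp (\<tau> * \<bar>Im z\<bar>)" for z
    by (rule phragmen_lindelof_exp_type[OF holH typeH \<tau> reH])
  then show "cmod (integral {a..b} (\<lambda>t. u t * g (z + of_real t))) \<le> L1_norm * exp (\<tau> * \<bar>Im z\<bar>)"
    by (simp add: H_def)
  have "L1_norm \<ge> 0" unfolding L1_norm_def by simp
  \<comment> \<open>Differentiation under the integral has identified the derivative of H, so
    Cauchy's estimate on the unit circle yields the second bound; its radius is the extra 1 in the
    exponent.\<close>
  have "cmod ((deriv ^^ 1) H z) \<le> fact 1 * (L1_norm * exp (\<tau> * (\<bar>Im z\<bar> + 1))) / 1 ^ 1"
  proof (rule Cauchy_inequality)
    fix x assume "cmod (z - x) = 1"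
    then have "\<bar>Im x\<bar> \<le> \<bar>Im z\<bar> + 1" using abs_Im_le_cmod[of "z - x"] by simp
    then have "L1_norm * exp (\<tau> * \<bar>Im x\<bar>) \<le> L1_norm * exp (\<tau> * (\<bar>Im z\<bar> + 1))"
      using \<tau> \<open>L1_norm \<ge> 0\<close> by (intro mult_left_mono) (auto intro!: mult_left_mono)
    then show "cmod (H x) \<le> L1_norm * exp (\<tau> * (\<bar>Im z\<bar> + 1))" using bound[of x] by simp
  qed (use holH in \<open>auto intro: holomorphic_on_subset holomorphic_on_imp_continuous_on\<close>)
  then show "cmod (integral {a..b} (\<lambda>t. u t * deriv g (z + of_real t))) \<le> L1_norm * exp (\<tau> * (\<bar>Im z\<bar> + 1))"
    using DERIV_imp_deriv[OF dH[of z]] by simp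
qed

end

text \<open>Taking \<open>u = cnj F / (|F| + \<delta>)\<close> turns a bound for all weighted integrals of \<open>F\<close> into one for the
  integral of \<open>|F|\<close>, without giving up continuity of the weight.\<close>

lemma integral_norm_le_by_duality:
  fixes F :: "real \<Rightarrow> complex"
  assumes F: "continuous_on {a..b} F"
    and bd: "\<And>u. continuous_on {a..b} u \<Longrightarrow> (\<And>t. t \<in> {a..b} \<Longrightarrow> cmod (u t) \<le> 1) \<Longrightarrow>
                 cmod (integral {a..b} (\<lambda>t. u t * F t)) \<le> B"
  shows "integral {a..b} (\<lambda>t. cmod (F t)) \<le> B"
proof -
  have main: "integral {a..b} (\<lambda>t. cmod (F t)) \<le> B + \<delta> * measure lborel {a..b}" if \<delta>: "\<delta> > 0" for \<delta>
  proof -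
    define u where "u = (\<lambda>t. cnj (F t) / of_real (cmod (F t) + \<delta>))"
    have pos: "cmod (F t) + \<delta> > 0" for t using \<delta> by (simp add: add_nonneg_pos)
    then have pos': "complex_of_real (cmod (F t) + \<delta>) \<noteq> 0" for t
      by (metis less_irrefl of_real_eq_0_iff)
    have cu: "continuous_on {a..b} u"
      unfolding u_def using pos' by (intro continuous_intros F) auto
    have nu: "cmod (u t) \<le> 1" for t
      using pos[of t] \<delta> by (simp add: u_def norm_divide del: of_real_add)
    have uF: "u t * F t = of_real ((cmod (F t))\<^sup>2 / (cmod (F t) + \<delta>))" for t
      using complex_norm_square[of "F t"]
      by (simp add: u_def mult.commute[of _ "F t"] del: of_real_add)
    have cq: "continuous_on {a..b} (\<lambda>t. (cmod (F t))\<^sup>2 / (cmod (F t) + \<delta>))"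
      using pos by (intro continuous_intros F) (metis less_irrefl)
    have "integral {a..b} (\<lambda>t. cmod (F t) - \<delta>)
        \<le> integral {a..b} (\<lambda>t. (cmod (F t))\<^sup>2 / (cmod (F t) + \<delta>))"
    proof (rule integral_le)
      fix t
      have "(cmod (F t) - \<delta>) * (cmod (F t) + \<delta>) \<le> (cmod (F t))\<^sup>2"
        by (simp add: power2_eq_square algebra_simps)
      then show "cmod (F t) - \<delta> \<le> (cmod (F t))\<^sup>2 / (cmod (F t) + \<delta>)"
        using pos[of t] by (simp add: field_simps)
    qed (auto intro!: integrable_continuous_interval continuous_intros F cq)
    also have "\<dots> \<le> \<bar>integral {a..b} (\<lambda>t. (cmod (F t))\<^sup>2 / (cmod (F t) + \<delta>))\<bar>" by simp
    also have "\<dots> = cmod (integral {a..b} (\<lambda>t. u t * F t))"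
      unfolding uF
      by (subst integral_unique[OF has_integral_of_real[OF integrable_integral[OF integrable_continuous_interval[OF cq]]]])
         simp
    also have "\<dots> \<le> B" by (rule bd[OF cu nu])
    finally have "integral {a..b} (\<lambda>t. cmod (F t) - \<delta>) \<le> B" .
    moreover have "integral {a..b} (\<lambda>t. cmod (F t) - \<delta>)
        = integral {a..b} (\<lambda>t. cmod (F t)) - integral {a..b} (\<lambda>t. \<delta>)"
      by (rule integral_diff) (auto intro!: integrable_continuous_interval continuous_intros F)
    ultimately show ?thesis by (simp add: mult.commute)
  qed
  have "((\<lambda>\<delta>. B + \<delta> * measure lborel {a..b}) \<longlongrightarrow> B + 0 * measure lborel {a..b}) (at_right 0)"
    by (intro tendsto_intros)
  moreover have "eventually (\<lambda>\<delta>. integral {a..b} (\<lambda>t. cmod (F t)) \<le> B + \<delta> * measure lborel {a..b}) (at_right 0)"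
    using main by (auto simp: eventually_at_filter)
  ultimately have "integral {a..b} (\<lambda>t. cmod (F t)) \<le> B + 0 * measure lborel {a..b}"
    by (rule tendsto_lowerbound) simp
  then show ?thesis by simp
qed

context L1_exp_type
begin

lemma integral_norm_line_le:
  "integral {a..b} (\<lambda>t. cmod (g (z + of_real t))) \<le> L1_norm * exp (\<tau> * \<bar>Im z\<bar>)"
  "integral {a..b} (\<lambda>t. cmod (deriv g (z + of_real t))) \<le> L1_norm * exp (\<tau> * (\<bar>Im z\<bar> + 1))"
  by (rule integral_norm_le_by_duality; (rule norm_integral_line_le)?; (intro continuous_intros)?; simp)+

text \<open>A Sobolev-type estimate: g(z) differs from g(z + s) by an integral of the derivative
  over [0, s], and averaging over s in [0, 1] removes the point evaluation. It converts sums over a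
  lattice into integrals over a line.\<close>

lemma norm_le_integral:
  "cmod (g z) \<le> integral {0..1} (\<lambda>t. cmod (g (z + of_real t)) + cmod (deriv g (z + of_real t)))"
proof -
  define J where "J = integral {0..1} (\<lambda>t. cmod (deriv g (z + of_real t)))"
  have "cmod (g z) \<le> cmod (g (z + of_real s)) + J" if s: "s \<in> {0..1}" for s
  proof -
    have "((\<lambda>t. deriv g (z + of_real t)) has_integral (g (z + of_real s) - g (z + of_real 0))) {0..s}"
    proof (rule fundamental_theorem_of_calculus)
      fix t
      have "((\<lambda>t. z + of_real t) has_vector_derivative 1) (at t within {0..s})"
        by (rule has_vector_derivative_eq_rhs,
            (rule has_vector_derivative_add has_vector_derivative_const has_vector_derivative_of_real DERIV_ident)+) simp
      then have "((\<lambda>t. g (z + of_real t)) has_vector_derivative 1 * deriv g (z + of_real t)) (at t within {0..s})"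
        using field_vector_diff_chain_within[of "\<lambda>t. z + of_real t" 1 t "{0..s}" g "deriv g (z + of_real t)"]
          deriv_g by (simp add: o_def)
      then show "((\<lambda>t. g (z + of_real t)) has_vector_derivative deriv g (z + of_real t)) (at t within {0..s})"
        by simp
    qed (use s in auto)
    then have "g (z + of_real s) - g z = integral {0..s} (\<lambda>t. deriv g (z + of_real t))"
      by (simp add: integral_unique)
    also have "cmod \<dots> \<le> integral {0..s} (\<lambda>t. cmod (deriv g (z + of_real t)))"
      by (rule integral_norm_bound_integral)
         (auto intro!: integrable_continuous_interval continuous_intros)
    also have "\<dots> \<le> J"
      unfolding J_def using s
      by (intro integral_subset_le integrable_continuous_interval continuous_intros) auto
    finally show ?thesis using norm_triangle_ineq2[of "g z" "g (z + of_real s)"]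
      by (simp add: norm_minus_commute)
  qed
  then have "integral {0..1} (\<lambda>s::real. cmod (g z)) \<le> integral {0..1} (\<lambda>s. cmod (g (z + of_real s)) + J)"
    by (intro integral_le integrable_continuous_interval continuous_intros) auto
  also have "\<dots> = integral {0..1} (\<lambda>s. cmod (g (z + of_real s))) + integral {0..1} (\<lambda>s::real. J)"
    by (intro integral_add integrable_continuous_interval continuous_intros)
  also have "\<dots> = integral {0..1} (\<lambda>t. cmod (g (z + of_real t)) + cmod (deriv g (z + of_real t)))"
    by (subst integral_add) (auto simp: J_def intro!: integrable_continuous_interval continuous_intros)
  finally show ?thesis by simp
qed

end

lemma integral_unit_intervals:
  fixes F :: "real \<Rightarrow> 'a::banach"
  assumes F: "continuous_on UNIV F"
  shows "(\<Sum>n\<in>{- int N..<int N}. integral {0..1} (\<lambda>t. F (t + of_int n))) = integral {- real N..real N} F"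
proof (induction N)
  case 0
  then show ?case by simp
next
  case (Suc N)
  have I: "F integrable_on {a..b}" for a b
    by (rule integrable_continuous_interval) (rule continuous_on_subset[OF F], simp)
  have shift: "integral {0..1} (\<lambda>t. F (t + c)) = integral {c..c + 1} F" for c
  proof -
    have "((\<lambda>t. F (t + c)) has_integral integral {c..c + 1} F) {c - c..c + 1 - c}"
      using has_integral_affinity[of F "integral {c..c+1} F" c "c+1" 1 c] integrable_integral[OF I]
      by (simp add: algebra_simps)
    then show ?thesis by (simp add: integral_unique)
  qed
  have eq: "{- int (Suc N)..<int (Suc N)} = insert (- int (Suc N)) (insert (int N) {- int N..<int N})"
    by auto
  have "integral {- real (Suc N)..real (Suc N)} F
      = integral {- real (Suc N)..- real N} F + (integral {- real N..real N} F + integral {real N..real (Suc N)} F)"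
    using Henstock_Kurzweil_Integration.integral_combine[OF _ _ I, of "- real (Suc N)" "- real N" "real (Suc N)"]
      Henstock_Kurzweil_Integration.integral_combine[OF _ _ I, of "- real N" "real N" "real (Suc N)"]
    by simp
  also have "integral {- real (Suc N)..- real N} F = integral {0..1} (\<lambda>t. F (t + of_int (- int (Suc N))))"
    by (subst shift) simp
  also have "integral {real N..real (Suc N)} F = integral {0..1} (\<lambda>t. F (t + of_int (int N)))"
    by (subst shift) (simp add: add.commute)
  finally show ?case unfolding eq using Suc.IH by (simp add: ac_simps)
qed

context L1_exp_type
begin

definition strip_bound :: "real \<Rightarrow> real" where "strip_bound y = L1_norm * exp (\<tau> * \<bar>y\<bar>) + L1_norm * exp (\<tau> * (\<bar>y\<bar> + 1))"

text \<open>An inequality of Plancherel-Polya kind. The unit segments starting at z + n tile a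
  horizontal line, so the local estimates add up to the L1 norms of g and its derivative there. The
  bound depends neither on the finite set nor on the real part of z.\<close>

lemma sum_norm_translates_le:
  assumes "finite F"
  shows "(\<Sum>n\<in>F. cmod (g (z + of_int n))) \<le> strip_bound (Im z)"
proof -
  define N where "N = nat (Max (insert 0 (abs ` F))) + 1"
  have "n \<in> {- int N..<int N}" if "n \<in> F" for n
  proof -
    have "\<bar>n\<bar> \<le> Max (insert 0 (abs ` F))" using assms that by (intro Max_ge) auto
    then show ?thesis by (auto simp: N_def)
  qed
  then have "(\<Sum>n\<in>F. cmod (g (z + of_int n))) \<le> (\<Sum>n\<in>{- int N..<int N}. cmod (g (z + of_int n)))"
    by (intro sum_mono2) auto
  also have "\<dots> \<le> (\<Sum>n\<in>{- int N..<int N}. integral {0..1}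
      (\<lambda>t. cmod (g (z + of_real (t + of_int n))) + cmod (deriv g (z + of_real (t + of_int n)))))"
    using norm_le_integral[of "z + of_int _"] by (intro sum_mono) (auto simp: add_ac)
  also have "\<dots> = integral {- real N..real N} (\<lambda>t. cmod (g (z + of_real t)) + cmod (deriv g (z + of_real t)))"
    by (rule integral_unit_intervals) (intro continuous_intros)
  also have "\<dots> = integral {- real N..real N} (\<lambda>t. cmod (g (z + of_real t)))
      + integral {- real N..real N} (\<lambda>t. cmod (deriv g (z + of_real t)))"
    by (intro integral_add integrable_continuous_interval continuous_intros)
  also have "\<dots> \<le> strip_bound (Im z)"
    unfolding strip_bound_def by (intro add_mono integral_norm_line_le)
  finally show ?thesis .
qed

end

section \<open>Periodization and the quadrature formula\<close>

lemma filterlim_int_intervals_finite_subsets_at_top: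
  "filterlim (\<lambda>N. {- int N..<int N}) (finite_subsets_at_top UNIV) sequentially"
  unfolding filterlim_finite_subsets_at_top
proof (intro allI impI)
  fix X :: "int set" assume X: "finite X \<and> X \<subseteq> UNIV"
  have "eventually (\<lambda>N. x \<in> {- int N..<int N}) sequentially" for x
    using eventually_gt_at_top[of "nat \<bar>x\<bar>"] by eventually_elim auto
  then have "eventually (\<lambda>N. \<forall>x\<in>X. x \<in> {- int N..<int N}) sequentially"
    using X by (simp add: eventually_ball_finite)
  then show "\<forall>\<^sub>F N in sequentially. finite {- int N..<int N} \<and> X \<subseteq> {- int N..<int N} \<and> {- int N..<int N} \<subseteq> UNIV"
    by eventually_elim auto
qed

text \<open>Writing \<open>h z = F w\<close> with \<open>w = exp (2\<pi>\<i>z)\<close>, the function \<open>w F w\<close> is bounded near \<open>0\<close> and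
  \<open>O(w\<^sup>2)\<close> at infinity, hence a quadratic polynomial.\<close>

lemma periodic_entire_trig_polynomial:
  assumes hol: "h holomorphic_on UNIV"
    and per: "\<And>z k::int. h (z + of_int k) = h z"
    and bound: "\<And>z. cmod (h z) \<le> C * exp (2 * pi * \<bar>Im z\<bar>)"
  shows "\<exists>a b c. \<forall>z. h z = a * exp (- (2 * of_real pi * \<i> * z)) + b + c * exp (2 * of_real pi * \<i> * z)"
proof -
  define F where "F = (\<lambda>w. h (Ln w / (2 * of_real pi * \<i>)))"
  have F: "F w = h (u / (2 * of_real pi * \<i>))" if "exp u = w" for u w
  proof -
    have "w \<noteq> 0" using that by auto
    then have "exp (Ln w) = exp u" using that by simp
    then obtain n :: int where "Ln w = u + (of_int (2 * n) * pi) * \<i>"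
      unfolding exp_eq by blast
    then have "Ln w / (2 * of_real pi * \<i>) = u / (2 * of_real pi * \<i>) + of_int n"
      by (simp add: field_simps)
    then show ?thesis unfolding F_def by (simp only: per)
  qed
  have C: "C \<ge> 0" using order_trans[OF norm_ge_zero bound[of 0]] by simp
  have nF: "cmod (F w) \<le> C * exp \<bar>ln (cmod w)\<bar>" if "w \<noteq> 0" for w
  proof -
    have "Im (Ln w / (2 * of_real pi * \<i>)) = - Re (Ln w) / (2 * pi)"
      by (simp add: Im_divide power2_eq_square)
    then have "2 * pi * \<bar>Im (Ln w / (2 * of_real pi * \<i>))\<bar> = \<bar>ln (cmod w)\<bar>"
      using that by (simp add: abs_mult)
    then show ?thesis using bound[of "Ln w / (2 * of_real pi * \<i>)"] by (simp add: F_def)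
  qed
  have hol1: "F holomorphic_on - \<real>\<^sub>\<le>\<^sub>0"
    unfolding F_def by (intro entire_compose[OF hol] holomorphic_intros) auto
  \<comment> \<open>The cut of \<open>Ln\<close> is an artefact: by periodicity of h any logarithm
    of w defines the same F. A branch cut along the other half-axis gives holomorphy there, and the
    two slit planes cover the punctured plane.\<close>
  have hol2: "F holomorphic_on - \<real>\<^sub>\<ge>\<^sub>0"
  proof -
    have "(\<lambda>w. h ((Ln (- w) + \<i> * of_real pi) / (2 * of_real pi * \<i>))) holomorphic_on - \<real>\<^sub>\<ge>\<^sub>0"
      by (intro entire_compose[OF hol] holomorphic_intros) auto
    moreover have "h ((Ln (- w) + \<i> * of_real pi) / (2 * of_real pi * \<i>)) = F w" if "w \<in> - \<real>\<^sub>\<ge>\<^sub>0" for w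
    proof (rule F[symmetric])
      have "w \<noteq> 0" using that by auto
      then show "exp (Ln (- w) + \<i> * of_real pi) = w" by (simp add: exp_add)
    qed
    ultimately show ?thesis by (rule holomorphic_transform)
  qed
  have "F holomorphic_on (- \<real>\<^sub>\<le>\<^sub>0 \<union> - \<real>\<^sub>\<ge>\<^sub>0)"
    by (intro holomorphic_on_Un hol1 hol2) (auto simp: open_Compl)
  moreover have "- \<real>\<^sub>\<le>\<^sub>0 \<union> - \<real>\<^sub>\<ge>\<^sub>0 = UNIV - {0 :: complex}"
    by (auto simp: complex_nonpos_Reals_iff complex_nonneg_Reals_iff complex_eq_iff)
  ultimately have holF: "F holomorphic_on UNIV - {0}" by simp
  have holG: "(\<lambda>w. w * F w) holomorphic_on UNIV - {0}"
    by (intro holomorphic_intros holF)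
  have "\<exists>B. eventually (\<lambda>w. cmod (w * F w) \<le> B) (at 0)"
  proof (intro exI)
    have "eventually (\<lambda>w::complex. w \<in> ball 0 1) (at 0)"
      by (intro eventually_at_in_open') auto
    moreover have "eventually (\<lambda>w::complex. w \<noteq> 0) (at 0)"
      by (simp add: eventually_at_filter)
    ultimately show "eventually (\<lambda>w. cmod (w * F w) \<le> C) (at 0)"
    proof eventually_elim
      case (elim w)
      then have "exp \<bar>ln (cmod w)\<bar> = 1 / cmod w"
        by (simp add: abs_of_neg exp_minus inverse_eq_divide)
      then have "cmod w * cmod (F w) \<le> cmod w * (C * (1 / cmod w))"
        using nF[of w] elim by (intro mult_left_mono) auto
      then show ?case using elim by (simp add: norm_mult)
    qed
  qed
  then obtain G where G: "G holomorphic_on UNIV" "\<And>w. w \<noteq> 0 \<Longrightarrow> G w = w * F w"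
    using holomorphic_on_extend_bounded[OF holG] by auto
  define c where "c = (\<lambda>k. (deriv ^^ k) G 0 / fact k)"
  have Gc: "G w = (\<Sum>k\<le>2. c k * w ^ k)" for w
    unfolding c_def
  proof (rule Liouville_polynomial[OF G(1)])
    fix w :: complex assume w: "1 \<le> cmod w"
    then have "w \<noteq> 0" by auto
    then have "cmod w * cmod (F w) \<le> cmod w * (C * exp \<bar>ln (cmod w)\<bar>)"
      using nF by (intro mult_left_mono) auto
    also have "\<dots> = C * cmod w ^ 2" using w \<open>w \<noteq> 0\<close> by (simp add: power2_eq_square)
    finally show "cmod (G w) \<le> C * cmod w ^ 2" using G(2)[OF \<open>w \<noteq> 0\<close>] by (simp add: norm_mult)
  qed
  show ?thesis
  proof (intro exI allI)
    fix z
    define w where "w = exp (2 * of_real pi * \<i> * z)"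
    have w: "w \<noteq> 0" by (simp add: w_def)
    have "h z = F w" by (subst F[of "2 * of_real pi * \<i> * z"]) (auto simp: w_def)
    also have "\<dots> = G w / w" using G(2)[OF w] w by simp
    also have "\<dots> = c 0 * inverse w + c 1 + c 2 * w"
      using w unfolding Gc by (simp add: numeral_2_eq_2 field_simps)
    also have "inverse w = exp (- (2 * of_real pi * \<i> * z))" by (simp add: w_def exp_minus)
    finally show "h z = c 0 * exp (- (2 * of_real pi * \<i> * z)) + c 1 + c 2 * exp (2 * of_real pi * \<i> * z)"
      by (simp add: w_def)
  qed
qed

section \<open>The periodization of an integrable function of exponential type\<close>

context L1_exp_type
begin

definition h :: "complex \<Rightarrow> complex" where "h z = (\<Sum>\<^sub>\<infinity>n. g (z + of_int n))"

lemma summable_norm_translates: "(\<lambda>n. cmod (g (z + of_int n))) summable_on UNIV"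
proof (rule nonneg_bdd_above_summable_on)
  show "bdd_above (sum (\<lambda>n. cmod (g (z + of_int n))) ` {F. F \<subseteq> UNIV \<and> finite F})"
    by (rule bdd_aboveI[of _ "strip_bound (Im z)"]) (auto intro: sum_norm_translates_le)
qed auto

lemma has_sum_h: "((\<lambda>n. g (z + of_int n)) has_sum h z) UNIV"
  unfolding h_def by (rule has_sum_infsum[OF abs_summable_summable[OF summable_norm_translates]])

lemma norm_h_le: "cmod (h z) \<le> strip_bound (Im z)"
proof -
  have "cmod (h z) \<le> (\<Sum>\<^sub>\<infinity>n. cmod (g (z + of_int n)))"
    unfolding h_def by (rule norm_infsum_bound[OF summable_norm_translates])
  also have "\<dots> \<le> strip_bound (Im z)"
    by (rule infsum_le_finite_sums[OF summable_norm_translates]) (rule sum_norm_translates_le)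
  finally show ?thesis .
qed

definition S :: "nat \<Rightarrow> complex \<Rightarrow> complex" where
  "S N z = (\<Sum>n\<in>{- int N..<int N}. g (z + of_int n))"

lemma S_tendsto: "(\<lambda>N. S N z) \<longlonglongrightarrow> h z"
  using filterlim_compose[OF has_sum_h[unfolded has_sum_def] filterlim_int_intervals_finite_subsets_at_top]
  by (simp add: S_def)

lemma norm_S_le: "cmod (S N z) \<le> strip_bound (Im z)"
  unfolding S_def by (rule order_trans[OF norm_sum sum_norm_translates_le]) simp

lemma L1_norm_nonneg: "L1_norm \<ge> 0" unfolding L1_norm_def by simp

lemma strip_bound_mono: "\<bar>x\<bar> \<le> \<bar>y\<bar> \<Longrightarrow> strip_bound x \<le> strip_bound y"
  unfolding strip_bound_def using L1_norm_nonneg \<tau> by (intro add_mono mult_left_mono) (auto intro!: mult_left_mono)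

text \<open>Pointwise convergence is enough: the symmetric partial sums are bounded on compact sets
  by \<open>strip_bound\<close>, so by Montel's theorem a subsequence has a holomorphic limit, which
  can only be h.\<close>

lemma holomorphic_h: "h holomorphic_on UNIV"
proof (rule Montel[of UNIV "range S" S])
  show "f holomorphic_on UNIV" if f: "f \<in> range S" for f
  proof -
    from f obtain N where "f = S N" by blast
    then have "f = (\<lambda>z. \<Sum>n\<in>{- int N..<int N}. g (z + of_int n))" by (auto simp: S_def)
    then show ?thesis by (auto intro!: holomorphic_intros entire_compose[OF hol])
  qed
  fix K :: "complex set" assume "compact K"
  then obtain R where R: "\<And>z. z \<in> K \<Longrightarrow> cmod z \<le> R"
    using compact_imp_bounded bounded_iff by metis
  have "cmod (S N z) \<le> strip_bound R" if "z \<in> K" for N z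
  proof -
    have "\<bar>Im z\<bar> \<le> \<bar>R\<bar>" using R[OF that] abs_Im_le_cmod[of z] by simp
    then show ?thesis using norm_S_le[of N z] strip_bound_mono order_trans by blast
  qed
  then show "\<exists>B. \<forall>f\<in>range S. \<forall>z\<in>K. cmod (f z) \<le> B" by blast
next
  fix f :: "complex \<Rightarrow> complex" and r :: "nat \<Rightarrow> nat"
  assume f: "f holomorphic_on UNIV" "strict_mono r" "\<And>x. x \<in> UNIV \<Longrightarrow> (\<lambda>n. S (r n) x) \<longlonglongrightarrow> f x"
  have "f x = h x" for x
    using LIMSEQ_unique[OF f(3)[of x] LIMSEQ_subseq_LIMSEQ[OF S_tendsto f(2), of x, unfolded o_def]] by simp
  then have "f = h" by auto
  then show "h holomorphic_on UNIV" using f(1) by simp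
qed auto

lemma h_periodic: "h (z + of_int k) = h z"
proof -
  have "bij (\<lambda>n. k + n)" by (rule bij_plus)
  then have "(\<Sum>\<^sub>\<infinity>n. g (z + of_int (k + n))) = (\<Sum>\<^sub>\<infinity>n. g (z + of_int n))"
    by (rule infsum_reindex_bij_betw)
  then show ?thesis by (simp add: h_def add_ac)
qed

lemma h_trig_polynomial:
  assumes "\<tau> \<le> 2 * pi"
  shows "\<exists>a b c. \<forall>z. h z = a * exp (- (2 * of_real pi * \<i> * z)) + b + c * exp (2 * of_real pi * \<i> * z)"
proof (rule periodic_entire_trig_polynomial[OF holomorphic_h h_periodic])
  fix z
  have "L1_norm * exp (\<tau> * \<bar>Im z\<bar>) \<le> L1_norm * exp (2 * pi * \<bar>Im z\<bar>)"
    using assms L1_norm_nonneg by (intro mult_left_mono) (auto intro!: mult_right_mono)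
  then have "strip_bound (Im z) \<le> (L1_norm + L1_norm * exp \<tau>) * exp (2 * pi * \<bar>Im z\<bar>)"
    using mult_right_mono[of "L1_norm * exp (\<tau> * \<bar>Im z\<bar>)" "L1_norm * exp (2 * pi * \<bar>Im z\<bar>)" "exp \<tau>"]
    by (simp add: strip_bound_def distrib_left distrib_right exp_add mult_ac)
  then show "cmod (h z) \<le> (L1_norm + L1_norm * exp \<tau>) * exp (2 * pi * \<bar>Im z\<bar>)"
    using norm_h_le[of z] by simp
qed

text \<open>If the type is strictly below 2\<pi>, a nonzero extreme coefficient would make h grow
  like exp (2\<pi>y) along one of the imaginary half-axes, against the bound of order exp (\<tau>y).
  The gap \<open>d\<close> is the rate at which the contradiction appears.\<close>

lemma h_constant:
  assumes "\<tau> < 2 * pi"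
  shows "h z = h 0"
proof -
  obtain ca cb cc where c: "\<And>z. h z = ca * exp (- (2 * of_real pi * \<i> * z)) + cb + cc * exp (2 * of_real pi * \<i> * z)"
    using h_trig_polynomial[OF less_imp_le[OF assms]] by blast
  define d where "d = 2 * pi - \<tau>"
  have d: "d > 0" using assms by (simp add: d_def)
  have zero: "cmod a = 0"
    if a: "\<And>y. y \<ge> 0 \<Longrightarrow> cmod a * exp (2 * pi * y) \<le> strip_bound y + cmod b + cmod b'" for a b b' :: complex
  proof -
    have "cmod a \<le> (L1_norm + L1_norm * exp \<tau>) * exp (- d * y) + (cmod b + cmod b') * exp (- 2 * pi * y)" if "y \<ge> 0" for y
    proof -
      have "cmod a = (cmod a * exp (2 * pi * y)) * exp (- 2 * pi * y)" by (simp add: exp_minus)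
      also have "\<dots> \<le> (strip_bound y + cmod b + cmod b') * exp (- 2 * pi * y)"
        by (intro mult_right_mono a that) auto
      also have "\<dots> = (L1_norm + L1_norm * exp \<tau>) * (exp (\<tau> * y) * exp (- 2 * pi * y)) + (cmod b + cmod b') * exp (- 2 * pi * y)"
        using that by (simp add: strip_bound_def distrib_left distrib_right exp_add)
      also have "exp (\<tau> * y) * exp (- 2 * pi * y) = exp (- d * y)"
        unfolding exp_add[symmetric] by (simp add: d_def algebra_simps)
      finally show ?thesis .
    qed
    then have "eventually (\<lambda>y. cmod a \<le> (L1_norm + L1_norm * exp \<tau>) * exp (- d * y) + (cmod b + cmod b') * exp (- 2 * pi * y)) at_top"
      by (intro eventually_mono[OF eventually_ge_at_top[of 0]]) auto
    moreover have "((\<lambda>y. (L1_norm + L1_norm * exp \<tau>) * exp (- d * y) + (cmod b + cmod b') * exp (- 2 * pi * y)) \<longlongrightarrow> 0) at_top"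
    proof (intro tendsto_add_zero tendsto_mult_right_zero)
      show "((\<lambda>y. exp (- d * y)) \<longlongrightarrow> 0) at_top" using d by real_asymp
      show "((\<lambda>y::real. exp (- 2 * pi * y)) \<longlongrightarrow> 0) at_top" by real_asymp
    qed
    ultimately have "cmod a \<le> 0" by (intro tendsto_lowerbound[where F = at_top]) auto
    then show ?thesis by simp
  qed
  have tri: "cmod u \<le> cmod (u + v + w) + cmod v + cmod w" for u v w :: complex
    using norm_triangle_ineq4[of "u + v + w" "v + w"] norm_triangle_ineq[of v w] by (simp add: algebra_simps)
  have "cmod (ca) = 0"
  proof (rule zero)
    fix y :: real assume y: "y \<ge> 0"
    have "h (\<i> * of_real y) = ca * of_real (exp (2 * pi * y)) + cb + cc * of_real (exp (- (2 * pi * y)))"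
    proof -
      have "2 * of_real pi * \<i> * (\<i> * of_real y) = complex_of_real (- (2 * pi * y))"
        by (simp add: complex_eq_iff)
      then show ?thesis by (simp only: c of_real_minus[symmetric] exp_of_real) simp
    qed
    then have "cmod (ca) * exp (2 * pi * y) \<le> cmod (h (\<i> * of_real y)) + cmod (cb) + cmod (cc) * exp (- (2 * pi * y))"
      using tri[of "ca * of_real (exp (2 * pi * y))" "cb" "cc * of_real (exp (- (2 * pi * y)))"]
      by (simp add: norm_mult)
    also have "\<dots> \<le> strip_bound y + cmod (cb) + cmod (cc)"
      using norm_h_le[of "\<i> * of_real y"] y mult_left_mono[of "exp (- (2 * pi * y))" 1 "cmod (cc)"] by simp
    finally show "cmod (ca) * exp (2 * pi * y) \<le> strip_bound y + cmod (cb) + cmod (cc)" .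
  qed
  moreover have "cmod (cc) = 0"
  proof (rule zero)
    fix y :: real assume y: "y \<ge> 0"
    have "h (- \<i> * of_real y) = cc * of_real (exp (2 * pi * y)) + cb + ca * of_real (exp (- (2 * pi * y)))"
    proof -
      have "2 * of_real pi * \<i> * (- \<i> * of_real y) = complex_of_real (2 * pi * y)"
        by (simp add: complex_eq_iff)
      then show ?thesis by (simp only: c of_real_minus[symmetric] exp_of_real) simp
    qed
    then have "cmod (cc) * exp (2 * pi * y) \<le> cmod (h (- \<i> * of_real y)) + cmod (cb) + cmod (ca) * exp (- (2 * pi * y))"
      using tri[of "cc * of_real (exp (2 * pi * y))" "cb" "ca * of_real (exp (- (2 * pi * y)))"]
      by (simp add: norm_mult)
    also have "\<dots> \<le> strip_bound y + cmod (cb) + cmod (ca)"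
      using norm_h_le[of "- \<i> * of_real y"] y mult_left_mono[of "exp (- (2 * pi * y))" 1 "cmod (ca)"]
      by (simp add: strip_bound_def)
    finally show "cmod (cc) * exp (2 * pi * y) \<le> strip_bound y + cmod (cb) + cmod (ca)" .
  qed
  ultimately show ?thesis by (simp add: c)
qed

text \<open>Unfolding: integrating the periodization over one period against a 1-periodic weight is
  integrating g over the line. With \<phi> a character this identifies Fourier coefficients of h
  with values of the Fourier transform of g. The constant \<open>strip_bound 0\<close> dominates all
  partial sums on the unit interval.\<close>

lemma integral_h:
  assumes \<phi>: "continuous_on UNIV \<phi>" "\<And>x (n::int). \<phi> (x + of_int n) = \<phi> x" "\<And>x. cmod (\<phi> x) \<le> 1"
  shows "((\<lambda>x. h (of_real x) * \<phi> x) has_integral (LINT x|lborel. g (of_real x) * \<phi> x)) {0..1}"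
proof -
  have [continuous_intros]: "continuous_on X \<phi>" for X using \<phi>(1) continuous_on_subset by blast
  have i: "integrable lborel (\<lambda>x. g (of_real x) * \<phi> x)"
  proof (rule Bochner_Integration.integrable_bound[OF int])
    have "continuous_on UNIV (\<lambda>x. g (of_real x) * \<phi> x)" by (intro continuous_intros)
    then show "(\<lambda>x. g (of_real x) * \<phi> x) \<in> borel_measurable lborel"
      by (simp add: borel_measurable_continuous_onI)
    show "AE x in lborel. cmod (g (of_real x) * \<phi> x) \<le> cmod (g (of_real x))"
      using \<phi>(3) by (auto simp: norm_mult mult_left_le)
  qed
  have SN: "integral {0..1} (\<lambda>x. S N (of_real x) * \<phi> x) = integral {- real N..real N} (\<lambda>x. g (of_real x) * \<phi> x)" for N
  proof -
    have "integral {0..1} (\<lambda>x. S N (of_real x) * \<phi> x)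
        = integral {0..1} (\<lambda>x. \<Sum>n\<in>{- int N..<int N}. g (of_real (x + of_int n)) * \<phi> (x + of_int n))"
      by (simp add: S_def sum_distrib_right \<phi>(2))
    also have "\<dots> = (\<Sum>n\<in>{- int N..<int N}. integral {0..1} (\<lambda>x. g (of_real (x + of_int n)) * \<phi> (x + of_int n)))"
      using \<phi>(2) by (intro integral_sum integrable_continuous_interval continuous_intros) (auto intro: continuous_intros)
    also have "\<dots> = integral {- real N..real N} (\<lambda>x. g (of_real x) * \<phi> x)"
      by (rule integral_unit_intervals) (intro continuous_intros)
    finally show ?thesis .
  qed
  have "(\<lambda>N. integral {- real N..real N} (\<lambda>x. g (of_real x) * \<phi> x)) \<longlonglongrightarrow> (LINT x|lborel. g (of_real x) * \<phi> x)"
  proof -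
    have "(\<lambda>N. LINT x|lborel. indicator {- real N..real N} x *\<^sub>R (g (of_real x) * \<phi> x))
        \<longlonglongrightarrow> (LINT x|lborel. g (of_real x) * \<phi> x)"
    proof (rule integral_dominated_convergence[OF _ _ integrable_norm[OF i]])
      show "AE x in lborel. (\<lambda>N. indicator {- real N..real N} x *\<^sub>R (g (of_real x) * \<phi> x)) \<longlonglongrightarrow> g (of_real x) * \<phi> x"
      proof (rule AE_I2)
        fix x :: real
        have "eventually (\<lambda>N. real N \<ge> \<bar>x\<bar>) sequentially"
          using eventually_ge_at_top[of "nat \<lceil>\<bar>x\<bar>\<rceil>"] by eventually_elim linarith
        then have "eventually (\<lambda>N. indicator {- real N..real N} x *\<^sub>R (g (of_real x) * \<phi> x) = g (of_real x) * \<phi> x) sequentially"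
          by eventually_elim (auto simp: indicator_def)
        then show "(\<lambda>N. indicator {- real N..real N} x *\<^sub>R (g (of_real x) * \<phi> x)) \<longlonglongrightarrow> g (of_real x) * \<phi> x"
          by (rule tendsto_eventually)
      qed
    qed (use i in \<open>auto simp: indicator_def\<close>)
    moreover have "(LINT x|lborel. indicator {- real N..real N} x *\<^sub>R (g (of_real x) * \<phi> x))
        = integral {- real N..real N} (\<lambda>x. g (of_real x) * \<phi> x)" for N
      using set_borel_integral_eq_integral(2)[of "{- real N..real N}" "\<lambda>x. g (of_real x) * \<phi> x"]
        integrable_mult_indicator[OF _ i, of "{- real N..real N}"]
      by (simp add: set_integrable_def set_lebesgue_integral_def)
    ultimately show ?thesis by simp
  qed
  moreover have "(\<lambda>N. integral {0..1} (\<lambda>x. S N (of_real x) * \<phi> x)) \<longlonglongrightarrow> integral {0..1} (\<lambda>x. h (of_real x) * \<phi> x)"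
  proof (rule dominated_convergence(2)[where h = "\<lambda>_. strip_bound 0"])
    show "(\<lambda>x. S N (of_real x) * \<phi> x) integrable_on {0..1}" for N
      unfolding S_def by (intro integrable_continuous_interval continuous_intros)
    show "cmod (S N (of_real x) * \<phi> x) \<le> strip_bound 0" for N x
    proof -
      have "cmod (S N (of_real x)) * cmod (\<phi> x) \<le> strip_bound 0 * 1"
        using norm_S_le[of N "of_real x"] \<phi>(3)[of x] by (intro mult_mono) (auto simp: strip_bound_def L1_norm_nonneg)
      then show ?thesis by (simp add: norm_mult)
    qed
    show "(\<lambda>N. S N (of_real x) * \<phi> x) \<longlonglongrightarrow> h (of_real x) * \<phi> x" for x
      by (intro tendsto_intros S_tendsto)
  qed auto
  ultimately have "integral {0..1} (\<lambda>x. h (of_real x) * \<phi> x) = (LINT x|lborel. g (of_real x) * \<phi> x)"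
    unfolding SN by (rule LIMSEQ_unique[rotated])
  moreover have "(\<lambda>x. h (of_real x) * \<phi> x) integrable_on {0..1}"
    by (intro integrable_continuous_interval continuous_intros
        continuous_on_compose2[OF holomorphic_on_imp_continuous_on[OF holomorphic_h]]) auto
  ultimately show ?thesis by (metis integrable_integral)
qed

end

section \<open>Fourier coefficients of the periodization, and the critical type 2\<pi>\<close>

lemma has_integral_cis_int:
  "((\<lambda>x. cis (2 * pi * of_int k * x)) has_integral (if k = 0 then 1 else 0)) {0..1}"
proof (cases "k = 0")
  case True
  then show ?thesis using has_integral_const_real[of "1::complex" 0 1] by simp
next
  case False
  define m where "m = 2 * pi * of_int k"
  have m: "m \<noteq> 0" using False by (simp add: m_def)
  have "((\<lambda>x. cis (m * x)) has_integral (cis (m * 1) / (\<i> * of_real m) - cis (m * 0) / (\<i> * of_real m))) {0..1}"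
  proof (rule fundamental_theorem_of_calculus)
    fix x :: real
    have "((\<lambda>x. exp (\<i> * of_real m * x) / (\<i> * of_real m)) has_field_derivative exp (\<i> * of_real m * of_real x)) (at (of_real x))"
      using m by (auto intro!: derivative_eq_intros)
    then have "((\<lambda>x. exp (\<i> * of_real m * of_real x) / (\<i> * of_real m)) has_vector_derivative exp (\<i> * of_real m * of_real x)) (at x within {0..1})"
      by (rule has_vector_derivative_real_field)
    then show "((\<lambda>x. cis (m * x) / (\<i> * of_real m)) has_vector_derivative cis (m * x)) (at x within {0..1})"
      by (simp add: cis_conv_exp mult_ac)
  qed auto
  moreover have "cis m = 1" unfolding m_def by (rule cis_multiple_2pi) simp
  ultimately show ?thesis using False by (simp add: m_def)
qed

text \<open>For s > 1 the function g(z/s) has type below 2\<pi>, so its periodization is constant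
  and its e-th Fourier coefficient vanishes; rescaled, the Fourier transform of g vanishes at
  frequency s e. The frequencies 1 and -1 sit at the edge of the admissible band and are reached by
  continuity as s tends to 1, with |g| as dominating function.\<close>

lemma fourier_integral_eq_0:
  assumes hol: "g holomorphic_on UNIV" and type: "exp_type_at_most (2 * pi) g"
    and int: "integrable lborel (\<lambda>x::real. g (of_real x))"
    and e: "e \<noteq> (0::int)"
  shows "(LINT x|lborel. g (of_real x) * cis (2 * pi * of_int e * x)) = 0"
proof -
  have main: "(LINT x|lborel. g (of_real x) * cis (2 * pi * of_int e * (s * x))) = 0" if s: "s > 1" for s :: real
  proof -
    interpret scaled: L1_exp_type "\<lambda>z. g (of_real (1 / s) * z)" "2 * pi * (1 / s)"
    proof
      show "(\<lambda>z. g (of_real (1 / s) * z)) holomorphic_on UNIV"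
        by (intro entire_compose[OF hol] holomorphic_intros)
      show "exp_type_at_most (2 * pi * (1 / s)) (\<lambda>z. g (of_real (1 / s) * z))"
        using s by (intro exp_type_at_most_scale type) auto
      show "integrable lborel (\<lambda>x. g (of_real (1 / s) * of_real x))"
        using lborel_integrable_real_affine[OF int, of "1 / s" 0] s by simp
    qed (use s in auto)
    have 1: "((\<lambda>x. scaled.h (of_real x) * cis (2 * pi * of_int e * x)) has_integral
        (LINT x|lborel. g (of_real (1 / s) * of_real x) * cis (2 * pi * of_int e * x))) {0..1}"
    proof (rule scaled.integral_h)
      have "cis (2 * pi * of_int e * of_int n) = 1" for n
        using cis_multiple_2pi[of "of_int (e * n)"] by (simp add: mult.assoc)
      then show "cis (2 * pi * of_int e * (x + of_int n)) = cis (2 * pi * of_int e * x)" for x n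
        by (simp add: distrib_left flip: cis_mult)
    qed (auto intro!: continuous_intros)
    have "2 * pi * (1 / s) < 2 * pi * 1"
      using s by (intro mult_strict_left_mono) auto
    then have const: "scaled.h z = scaled.h 0" for z
      by (intro scaled.h_constant) simp
    have 2: "((\<lambda>x. scaled.h (of_real x) * cis (2 * pi * of_int e * x)) has_integral scaled.h 0 * 0) {0..1}"
      by (subst const, rule has_integral_mult_right) (use has_integral_cis_int[of e] e in simp)
    have "(LINT x|lborel. g (of_real (1 / s) * of_real x) * cis (2 * pi * of_int e * x)) = 0"
      using has_integral_unique[OF 1 2] by simp
    then have "s *\<^sub>R (LINT x|lborel. g (of_real x) * cis (2 * pi * of_int e * (s * x))) = 0"
      using lborel_integral_real_affine[where c = s and t = 0 and
          f = "\<lambda>x. g (of_real (1 / s) * of_real x) * cis (2 * pi * of_int e * x)"] s by simp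
    then show ?thesis using s by simp
  qed
  define s where "s = (\<lambda>n. 1 + inverse (real (Suc n)))"
  have s1: "s \<longlonglongrightarrow> 1" unfolding s_def using tendsto_add[OF tendsto_const LIMSEQ_inverse_real_of_nat, of 1] by simp
  have cg: "continuous_on UNIV (\<lambda>x::real. g (of_real x))"
    by (rule continuous_on_compose2[OF holomorphic_on_imp_continuous_on[OF hol]]) (auto intro!: continuous_intros)
  have meas: "(\<lambda>x. g (of_real x) * cis (2 * pi * of_int e * (r * x))) \<in> borel_measurable lborel" for r :: real
  proof -
    have "continuous_on UNIV (\<lambda>x. g (of_real x) * cis (2 * pi * of_int e * (r * x)))" by (intro continuous_intros cg)
    then show ?thesis by (simp add: borel_measurable_continuous_onI)
  qed
  have "(\<lambda>n. LINT x|lborel. g (of_real x) * cis (2 * pi * of_int e * (s n * x)))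
      \<longlonglongrightarrow> (LINT x|lborel. g (of_real x) * cis (2 * pi * of_int e * (1 * x)))"
  proof (rule integral_dominated_convergence[OF _ _ integrable_norm[OF int]])
    show "AE x in lborel. (\<lambda>n. g (of_real x) * cis (2 * pi * of_int e * (s n * x)))
        \<longlonglongrightarrow> g (of_real x) * cis (2 * pi * of_int e * (1 * x))"
      by (intro AE_I2 tendsto_intros s1)
    show "AE x in lborel. cmod (g (of_real x) * cis (2 * pi * of_int e * (s n * x))) \<le> cmod (g (of_real x))" for n
      by (simp add: norm_mult)
  qed (rule meas)+
  moreover have "(LINT x|lborel. g (of_real x) * cis (2 * pi * of_int e * (s n * x))) = 0" for n
    by (rule main) (simp add: s_def)
  ultimately show ?thesis by (simp add: LIMSEQ_const_iff)
qed

theorem has_sum_translates_eq_integral: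
  assumes hol: "g holomorphic_on UNIV" and type: "exp_type_at_most (2 * pi) g"
    and int: "integrable lborel (\<lambda>x::real. g (of_real x))"
  shows "((\<lambda>n::int. g (a + of_int n)) has_sum (LINT x|lborel. g (of_real x))) UNIV"
proof -
  interpret L1_exp_type g "2 * pi" by standard (use assms in auto)
  obtain ca cb cc where c: "\<And>z. h z = ca * exp (- (2 * of_real pi * \<i> * z)) + cb + cc * exp (2 * of_real pi * \<i> * z)"
    using h_trig_polynomial[OF order_refl] by blast
  have hc: "h (of_real x) * cis (2 * pi * of_int k * x) = ca * cis (2 * pi * of_int (k - 1) * x)
      + cb * cis (2 * pi * of_int k * x) + cc * cis (2 * pi * of_int (k + 1) * x)" for x k
  proof -
    have "exp (- (2 * of_real pi * \<i> * of_real x)) = cis (2 * pi * (- 1) * x)"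
      "exp (2 * of_real pi * \<i> * of_real x) = cis (2 * pi * 1 * x)"
      by (simp_all add: cis_conv_exp mult_ac)
    then show ?thesis
      by (simp add: c distrib_right mult.assoc cis_mult) (simp add: algebra_simps)
  qed
  have coeff: "(LINT x|lborel. g (of_real x) * cis (2 * pi * of_int k * x))
      = ca * (if k - 1 = 0 then 1 else 0) + cb * (if k = 0 then 1 else 0) + cc * (if k + 1 = 0 then 1 else 0)" for k
  proof (rule has_integral_unique)
    show "((\<lambda>x. h (of_real x) * cis (2 * pi * of_int k * x)) has_integral
        (LINT x|lborel. g (of_real x) * cis (2 * pi * of_int k * x))) {0..1}"
    proof (rule integral_h)
      have "cis (2 * pi * of_int k * of_int n) = 1" for n
        using cis_multiple_2pi[of "of_int (k * n)"] by (simp add: mult.assoc)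
      then show "cis (2 * pi * of_int k * (x + of_int n)) = cis (2 * pi * of_int k * x)" for x n
        by (simp add: distrib_left flip: cis_mult)
    qed (auto intro!: continuous_intros)
    show "((\<lambda>x. h (of_real x) * cis (2 * pi * of_int k * x)) has_integral
      ca * (if k - 1 = 0 then 1 else 0) + cb * (if k = 0 then 1 else 0) + cc * (if k + 1 = 0 then 1 else 0)) {0..1}"
      unfolding hc by (intro has_integral_add has_integral_mult_right has_integral_cis_int)
  qed
  \<comment> \<open>Multiplication by the character of index k shifts frequencies by k, so k = 1
    isolates the coefficient of exp (-2\<pi>\<i>z) and k = -1 that of exp (2\<pi>\<i>z).\<close>
  have "ca = 0" using coeff[of 1] fourier_integral_eq_0[OF assms, of 1] by simp
  moreover have "cc = 0" using coeff[of "-1"] fourier_integral_eq_0[OF assms, of "-1"] by simp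
  moreover have "cb = (LINT x|lborel. g (of_real x))" using coeff[of 0] by simp
  ultimately have "h a = (LINT x|lborel. g (of_real x))" by (simp add: c)
  then show ?thesis using has_sum_h[of a] by simp
qed

section \<open>The Paley--Wiener space and its samples\<close>

lemma sinc_pi_of_real: "sinc_pi (of_real x :: complex) = of_real (sinc_pi x)"
  by (simp add: sinc_pi_def sin_of_real flip: of_real_mult of_real_divide)

lemma sinc_pi_int: "sinc_pi (of_int n :: real) = (if n = 0 then 1 else 0)"
  using sin_zero_iff_int2[of "pi * of_int n"] by (auto simp: sinc_pi_def)

lemma holomorphic_sinc_pi: "(sinc_pi :: complex \<Rightarrow> complex) holomorphic_on UNIV"
proof -
  define f :: "complex \<Rightarrow> complex" where "f = (\<lambda>z. sin (of_real pi * z) / of_real pi)"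
  have "f holomorphic_on UNIV" unfolding f_def by (intro holomorphic_intros) auto
  then have "(\<lambda>z. if z = 0 then deriv f 0 else (f z - f 0) / (z - 0)) holomorphic_on UNIV"
    by (rule pole_lemma) simp
  moreover have d: "deriv f 0 = 1"
    unfolding f_def by (rule DERIV_imp_deriv) (auto intro!: derivative_eq_intros)
  have "(if z = 0 then deriv f 0 else (f z - f 0) / (z - 0)) = sinc_pi z" for z
    by (cases "z = 0") (simp add: d sinc_pi_def, simp add: f_def sinc_pi_def)
  ultimately show ?thesis by simp
qed

text \<open>The mean value inequality for sin on a disc, with |cos| \<le> exp |.|, gives |sin w|
  \<le> |w| exp |w|. The factor |w| cancels the denominator, so no separate estimate near 0 is
  required.\<close>

lemma norm_sinc_pi_le: "cmod (sinc_pi z) \<le> exp (pi * cmod z)"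
proof (cases "z = 0")
  case False
  define w where "w = of_real pi * z"
  have w: "w \<noteq> 0" using False by (simp add: w_def)
  have "cmod (sin w - sin 0) \<le> exp (cmod w) * cmod (w - 0)"
  proof (rule field_differentiable_bound[where S = "cball 0 (cmod w)" and f' = cos])
    show "(sin has_field_derivative cos x) (at x within cball 0 (cmod w))" for x :: complex
      by (auto intro!: derivative_eq_intros)
    show "cmod (cos x) \<le> exp (cmod w)" if "x \<in> cball 0 (cmod w)" for x
      using norm_cos_le[of x] that by (meson dual_order.trans exp_le_cancel_iff mem_cball_0)
  qed auto
  then have "cmod (sin w) / cmod w \<le> exp (cmod w)" using w by (simp add: divide_le_eq)
  then show ?thesis using False by (simp add: sinc_pi_def w_def norm_divide norm_mult)
qed (simp add: sinc_pi_def)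

lemma exp_type_sinc_pi: "exp_type_at_most pi sinc_pi"
  unfolding exp_type_at_most_def
proof (intro allI impI exI)
  fix \<epsilon> :: real and z assume "\<epsilon> > 0"
  then have "exp (pi * cmod z) \<le> 1 * exp ((pi + \<epsilon>) * cmod z)" by (auto intro!: mult_right_mono)
  then show "cmod (sinc_pi z) \<le> 1 * exp ((pi + \<epsilon>) * cmod z)" using norm_sinc_pi_le[of z] by linarith
qed

lemma abs_sinc_pi_le_1: "\<bar>sinc_pi (x::real)\<bar> \<le> 1"
  using abs_sin_x_le_abs_x[of "pi * x"] by (simp add: sinc_pi_def divide_le_eq abs_mult)

lemma sinc_pi_sq_le_1: "(sinc_pi (x::real))\<^sup>2 \<le> 1"
  using abs_sinc_pi_le_1[of x] by (simp add: abs_square_le_1)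

lemma continuous_sinc_pi: "continuous_on UNIV (sinc_pi :: real \<Rightarrow> real)"
proof -
  have "continuous_on UNIV (\<lambda>x::real. Re (sinc_pi (of_real x)))"
    by (intro continuous_intros continuous_on_compose2[OF holomorphic_on_imp_continuous_on[OF holomorphic_sinc_pi]]) auto
  then show ?thesis by (simp add: sinc_pi_of_real)
qed

text \<open>Both sinc^2 and x^2 sinc^2 are at most 1; adding the two bounds yields the integrable
  majorant 2/(1 + x^2).\<close>

lemma integrable_sinc_pi_sq: "integrable lborel (\<lambda>x::real. (sinc_pi x)\<^sup>2)"
proof (rule Bochner_Integration.integrable_bound)
  show "integrable lborel (\<lambda>x::real. 2 * inverse (1 + x\<^sup>2))"
    using integrable_inverse_1_plus_square by (simp add: set_integrable_def)
  have "continuous_on UNIV (\<lambda>x::real. (sinc_pi x)\<^sup>2)" by (intro continuous_intros continuous_sinc_pi)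
  then show "(\<lambda>x::real. (sinc_pi x)\<^sup>2) \<in> borel_measurable lborel"
    by (simp add: borel_measurable_continuous_onI)
  show "AE x::real in lborel. norm ((sinc_pi x)\<^sup>2) \<le> norm (2 * inverse (1 + x\<^sup>2))"
  proof (rule AE_I2)
    fix x :: real
    have pos: "1 + x\<^sup>2 > 0" by (simp add: add_pos_nonneg)
    have "(sinc_pi x)\<^sup>2 * x\<^sup>2 \<le> 1"
    proof (cases "x = 0")
      case False
      then have "(sinc_pi x)\<^sup>2 * x\<^sup>2 = (sin (pi * x) / pi)\<^sup>2"
        by (simp add: sinc_pi_def power_divide power_mult_distrib)
      also have "\<dots> \<le> 1"
      proof -
        have "\<bar>sin (pi * x)\<bar> \<le> pi" using abs_sin_le_one[of "pi * x"] pi_gt3 by linarith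
        then have "\<bar>sin (pi * x) / pi\<bar> \<le> 1" by (simp add: abs_divide divide_le_eq)
        then show ?thesis by (simp only: abs_square_le_1)
      qed
      finally show ?thesis by simp
    qed auto
    then have "(sinc_pi x)\<^sup>2 * (1 + x\<^sup>2) \<le> 2"
      using sinc_pi_sq_le_1[of x] by (simp add: distrib_left)
    then show "norm ((sinc_pi x)\<^sup>2) \<le> norm (2 * inverse (1 + x\<^sup>2))"
      using pos by (simp add: field_simps)
  qed
qed

lemma sinc_pi_in_paley_wiener: "sinc_pi \<in> paley_wiener pi"
  using holomorphic_sinc_pi exp_type_sinc_pi integrable_sinc_pi_sq
  by (simp add: paley_wiener_def sinc_pi_of_real)

section \<open>Linear structure and translation invariance of the Paley-Wiener space\<close>

lemma paley_wiener_shift: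
  assumes "f \<in> paley_wiener \<tau>" "\<tau> \<ge> 0"
  shows "(\<lambda>z. f (z + of_real a)) \<in> paley_wiener \<tau>"
proof -
  have f: "f holomorphic_on UNIV" "exp_type_at_most \<tau> f" "integrable lborel (\<lambda>x::real. (cmod (f (of_real x)))\<^sup>2)"
    using assms by (auto simp: paley_wiener_def)
  have "(\<lambda>z. f (z + of_real a)) holomorphic_on UNIV"
    by (intro entire_compose[OF f(1)] holomorphic_intros)
  moreover have "integrable lborel (\<lambda>x. (cmod (f (of_real x + of_real a)))\<^sup>2)"
    using lborel_integrable_real_affine[OF f(3), of 1 a] by (simp add: add.commute)
  ultimately show ?thesis
    using exp_type_at_most_shift[OF f(2) assms(2)] by (simp add: paley_wiener_def)
qed

lemma borel_measurable_entire:
  assumes "f holomorphic_on UNIV"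
  shows "(\<lambda>x::real. f (of_real x)) \<in> borel_measurable lborel"
proof -
  have "continuous_on UNIV (\<lambda>x::real. f (of_real x))"
    by (rule continuous_on_compose2[OF holomorphic_on_imp_continuous_on[OF assms]]) (auto intro!: continuous_intros)
  then show ?thesis by (simp add: borel_measurable_continuous_onI)
qed

lemma paley_wiener_cmult:
  assumes "f \<in> paley_wiener \<tau>"
  shows "(\<lambda>z. c * f z) \<in> paley_wiener \<tau>"
  using assms exp_type_at_most_cmult[of \<tau> f c]
  by (auto simp: paley_wiener_def norm_mult power_mult_distrib intro!: holomorphic_intros)

lemma paley_wiener_add:
  assumes "f \<in> paley_wiener \<tau>" "g \<in> paley_wiener \<tau>"
  shows "(\<lambda>z. f z + g z) \<in> paley_wiener \<tau>"
proof -
  have f: "f holomorphic_on UNIV" "exp_type_at_most \<tau> f" "integrable lborel (\<lambda>x::real. (cmod (f (of_real x)))\<^sup>2)"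
    and g: "g holomorphic_on UNIV" "exp_type_at_most \<tau> g" "integrable lborel (\<lambda>x::real. (cmod (g (of_real x)))\<^sup>2)"
    using assms by (auto simp: paley_wiener_def)
  have "integrable lborel (\<lambda>x::real. (cmod (f (of_real x) + g (of_real x)))\<^sup>2)"
  proof (rule Bochner_Integration.integrable_bound)
    show "integrable lborel (\<lambda>x::real. 2 * (cmod (f (of_real x)))\<^sup>2 + 2 * (cmod (g (of_real x)))\<^sup>2)"
      using f(3) g(3) by auto
    show "(\<lambda>x::real. (cmod (f (of_real x) + g (of_real x)))\<^sup>2) \<in> borel_measurable lborel"
      using borel_measurable_entire[OF f(1)] borel_measurable_entire[OF g(1)] by measurable
    show "AE x in lborel. norm ((cmod (f (of_real x) + g (of_real x)))\<^sup>2)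
        \<le> norm (2 * (cmod (f (of_real x)))\<^sup>2 + 2 * (cmod (g (of_real x)))\<^sup>2)"
    proof (rule AE_I2)
      fix x :: real
      have "(cmod (f (of_real x) + g (of_real x)))\<^sup>2 \<le> (cmod (f (of_real x)) + cmod (g (of_real x)))\<^sup>2"
        by (intro power_mono norm_triangle_ineq) auto
      also have "\<dots> \<le> 2 * (cmod (f (of_real x)))\<^sup>2 + 2 * (cmod (g (of_real x)))\<^sup>2"
        using sum_squares_bound[of "cmod (f (of_real x))" "cmod (g (of_real x))"] by (simp add: power2_sum)
      finally show "norm ((cmod (f (of_real x) + g (of_real x)))\<^sup>2)
        \<le> norm (2 * (cmod (f (of_real x)))\<^sup>2 + 2 * (cmod (g (of_real x)))\<^sup>2)" by simp
    qed
  qed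
  then show ?thesis
    using f g exp_type_at_most_add[OF f(2) g(2)]
    by (auto simp: paley_wiener_def intro!: holomorphic_intros)
qed

section \<open>Reflection in the real axis and the sampling identities\<close>

lemma exp_type_at_most_cnj:
  assumes "exp_type_at_most \<tau> f"
  shows "exp_type_at_most \<tau> (\<lambda>z. cnj (f (cnj z)))"
  unfolding exp_type_at_most_def
proof (intro allI impI)
  fix \<epsilon> :: real assume "\<epsilon> > 0"
  then obtain C where C: "\<And>z. cmod (f z) \<le> C * exp ((\<tau> + \<epsilon>) * cmod z)"
    using exp_type_at_mostE[OF assms] by blast
  show "\<exists>C. \<forall>z. cmod (cnj (f (cnj z))) \<le> C * exp ((\<tau> + \<epsilon>) * cmod z)"
    using C[of "cnj _"] by auto
qed

lemma holomorphic_cnj_cnj: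
  assumes "f holomorphic_on UNIV"
  shows "(\<lambda>z. cnj (f (cnj z))) holomorphic_on UNIV"
proof -
  have "cnj \<circ> f \<circ> cnj holomorphic_on UNIV"
    by (rule holomorphic_on_compose_cnj_cnj) (auto intro: holomorphic_on_subset[OF assms])
  then show ?thesis by (simp add: o_def)
qed

lemma paley_wienerD:
  assumes "f \<in> paley_wiener \<tau>"
  shows "f holomorphic_on UNIV" "exp_type_at_most \<tau> f"
    "integrable lborel (\<lambda>x::real. (cmod (f (of_real x)))\<^sup>2)"
  using assms by (auto simp: paley_wiener_def)

text \<open>On the real line |f|^2 agrees with the entire function f(z) cnj (f (cnj z)). Its type
  \<pi> + \<pi> is the largest that the quadrature formula allows.\<close>

lemma has_sum_norm_sq_samples:
  assumes "f \<in> paley_wiener pi"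
  shows "((\<lambda>n::int. (cmod (f (of_real (a + of_int n))))\<^sup>2) has_sum (LINT x|lborel. (cmod (f (of_real x)))\<^sup>2)) UNIV"
proof -
  note f = paley_wienerD[OF assms]
  define g where "g = (\<lambda>z. f z * cnj (f (cnj z)))"
  have g: "g (of_real x) = of_real ((cmod (f (of_real x)))\<^sup>2)" for x
    by (simp only: g_def complex_cnj_complex_of_real complex_norm_square)
  have "((\<lambda>n::int. g (of_real a + of_int n)) has_sum (LINT x|lborel. g (of_real x))) UNIV"
  proof (rule has_sum_translates_eq_integral)
    show "g holomorphic_on UNIV"
      unfolding g_def by (intro holomorphic_intros f holomorphic_cnj_cnj)
    show "exp_type_at_most (2 * pi) g"
      using exp_type_at_most_mult[OF f(2) exp_type_at_most_cnj[OF f(2)]] by (simp add: g_def)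
    show "integrable lborel (\<lambda>x. g (of_real x))"
      unfolding g using f(3) by (rule integrable_of_real)
  qed
  moreover have "of_real a + of_int n = complex_of_real (a + of_int n)" for n by simp
  ultimately show ?thesis
    by (simp only: g integral_complex_of_real has_sum_of_real_iff)
qed

text \<open>Since the sampling identity holds on every translate of the integers, norm zero forces f
  to vanish at each real point itself, not merely almost everywhere; Phragmen-Lindeloef with bound 0
  does the rest.\<close>

lemma paley_wiener_eq_0:
  assumes f: "f \<in> paley_wiener pi" and N: "(LINT x|lborel. (cmod (f (of_real x)))\<^sup>2) = 0"
  shows "f = (\<lambda>z. 0)"
proof
  fix z
  have "cmod (f (of_real t)) \<le> 0" for t :: real
  proof -
    have "(cmod (f (of_real (t + of_int 0))))\<^sup>2 = 0"
      by (rule nonneg_has_sum_le_0D[OF has_sum_norm_sq_samples[OF f, of t]]) (auto simp: N)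
    then show ?thesis by simp
  qed
  then have "cmod (f z) \<le> 0 * exp (pi * \<bar>Im z\<bar>)"
    using paley_wienerD[OF f] by (intro phragmen_lindelof_exp_type) auto
  then show "f z = 0" by simp
qed

text \<open>The integral of f sinc is evaluated on two lattices. On the integers sinc annihilates
  every term but f(0); on the half-integers the same integral is the series.\<close>

lemma has_sum_samples_sinc:
  assumes "f \<in> paley_wiener pi"
  shows "((\<lambda>n::int. f (of_real (1/2 + of_int n)) * of_real (sinc_pi (1/2 + of_int n))) has_sum f 0) UNIV"
proof -
  note f = paley_wienerD[OF assms]
  define g where "g = (\<lambda>z. f z * sinc_pi z)"
  have sum: "((\<lambda>n::int. g (a + of_int n)) has_sum (LINT x|lborel. g (of_real x))) UNIV" for a
  proof (rule has_sum_translates_eq_integral)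
    show "g holomorphic_on UNIV"
      unfolding g_def by (intro holomorphic_intros f holomorphic_sinc_pi)
    show "exp_type_at_most (2 * pi) g"
      using exp_type_at_most_mult[OF f(2) exp_type_sinc_pi] by (simp add: g_def)
    show "integrable lborel (\<lambda>x. g (of_real x))"
    proof (rule Bochner_Integration.integrable_bound)
      show "integrable lborel (\<lambda>x::real. (cmod (f (of_real x)))\<^sup>2 + (sinc_pi x)\<^sup>2)"
        using f(3) integrable_sinc_pi_sq by simp
      show "(\<lambda>x. g (of_real x)) \<in> borel_measurable lborel"
        unfolding g_def by (intro borel_measurable_entire holomorphic_intros f holomorphic_sinc_pi)
      show "AE x::real in lborel. cmod (g (of_real x)) \<le> norm ((cmod (f (of_real x)))\<^sup>2 + (sinc_pi x)\<^sup>2)"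
      proof (rule AE_I2)
        fix x :: real
        have "2 * (cmod (f (of_real x)) * \<bar>sinc_pi x\<bar>) \<le> (cmod (f (of_real x)))\<^sup>2 + \<bar>sinc_pi x\<bar>\<^sup>2"
          using sum_squares_bound[of "cmod (f (of_real x))" "\<bar>sinc_pi x\<bar>"] by (simp only: mult.assoc)
        moreover have "0 \<le> cmod (f (of_real x)) * \<bar>sinc_pi x\<bar>" by simp
        ultimately have "cmod (f (of_real x)) * \<bar>sinc_pi x\<bar> \<le> (cmod (f (of_real x)))\<^sup>2 + \<bar>sinc_pi x\<bar>\<^sup>2"
          by linarith
        then show "cmod (g (of_real x)) \<le> norm ((cmod (f (of_real x)))\<^sup>2 + (sinc_pi x)\<^sup>2)"
          by (simp add: g_def norm_mult sinc_pi_of_real)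
      qed
    qed
  qed
  have g0: "g (0 + of_int n) = (if n = 0 then f 0 else 0)" for n
    using sinc_pi_of_real[of "of_int n"] by (simp add: g_def sinc_pi_int)
  have "((\<lambda>n::int. g (0 + of_int n)) has_sum f 0) UNIV"
    unfolding g0 using has_sum_finite[of "{0::int}" "\<lambda>n. f 0"]
    by (subst has_sum_cong_neutral[where T = "{0}" and g = "\<lambda>_. f 0"]) auto
  with sum[of 0] have "(LINT x|lborel. g (of_real x)) = f 0" by (rule has_sum_unique)
  with sum[of "1/2"] have "((\<lambda>n::int. g (1/2 + of_int n)) has_sum f 0) UNIV" by simp
  moreover have "g (1/2 + of_int n) = f (of_real (1/2 + of_int n)) * of_real (sinc_pi (1/2 + of_int n))" for n
    using sinc_pi_of_real[of "1/2 + of_int n"] by (simp add: g_def)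
  ultimately show ?thesis by simp
qed

lemma integrable_sinc_weighted:
  assumes "f \<in> paley_wiener pi"
  shows "integrable lborel (\<lambda>x::real. (cmod (f (of_real x)))\<^sup>2 * (sinc_pi x)\<^sup>2)"
proof (rule Bochner_Integration.integrable_bound[OF paley_wienerD(3)[OF assms]])
  have "continuous_on UNIV (\<lambda>x::real. (cmod (f (of_real x)))\<^sup>2 * (sinc_pi x)\<^sup>2)"
    by (intro continuous_intros continuous_sinc_pi
        continuous_on_compose2[OF holomorphic_on_imp_continuous_on[OF paley_wienerD(1)[OF assms]]]) auto
  then show "(\<lambda>x::real. (cmod (f (of_real x)))\<^sup>2 * (sinc_pi x)\<^sup>2) \<in> borel_measurable lborel"
    by (simp add: borel_measurable_continuous_onI)
  show "AE x::real in lborel. norm ((cmod (f (of_real x)))\<^sup>2 * (sinc_pi x)\<^sup>2) \<le> norm ((cmod (f (of_real x)))\<^sup>2)"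
    using sinc_pi_sq_le_1 by (auto intro!: AE_I2 mult_left_le)
qed

text \<open>The integrand |f|^2 sinc^2 extends to type 4\<pi>, so it is halved in scale before
  quadrature: this samples at n/2 and doubles the integral. Even n are integer points, of which only
  0 survives the zeros of sinc; odd n are the half-integers.\<close>

lemma has_sum_weighted_samples:
  assumes "f \<in> paley_wiener pi"
  shows "((\<lambda>n::int. (cmod (f (of_real (1/2 + of_int n))))\<^sup>2 * (sinc_pi (1/2 + of_int n))\<^sup>2) has_sum
    (2 * (LINT x|lborel. (cmod (f (of_real x)))\<^sup>2 * (sinc_pi x)\<^sup>2) - (cmod (f 0))\<^sup>2)) UNIV"
proof -
  note f = paley_wienerD[OF assms]
  define Q where "Q = (LINT x|lborel. (cmod (f (of_real x)))\<^sup>2 * (sinc_pi x)\<^sup>2)"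
  define g where "g = (\<lambda>z. f z * cnj (f (cnj z)) * (sinc_pi z * sinc_pi z))"
  define G where "G = (\<lambda>z. g (of_real (1/2) * z))"
  define u where "u = (\<lambda>x. (cmod (f (of_real x)))\<^sup>2 * (sinc_pi x)\<^sup>2)"
  have g: "g (of_real x) = of_real (u x)" for x
    by (simp add: g_def u_def sinc_pi_of_real complex_norm_square power2_eq_square flip: complex_norm_square)
  have G: "G (of_real x) = of_real (u (x / 2))" for x
    using g[of "x / 2"] by (simp add: G_def)
  have iu: "integrable lborel u" using integrable_sinc_weighted[OF assms] by (simp add: u_def)
  have iu2: "integrable lborel (\<lambda>x. u (x / 2))"
    using lborel_integrable_real_affine[OF iu, of "1/2" 0] by simp
  have LG: "(LINT x|lborel. u (x / 2)) = 2 * Q"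
    using lborel_integral_real_affine[of 2 "\<lambda>x. u (x / 2)" 0] by (simp add: Q_def u_def)
  have "((\<lambda>n::int. G (0 + of_int n)) has_sum (LINT x|lborel. G (of_real x))) UNIV"
  proof (rule has_sum_translates_eq_integral)
    have "g holomorphic_on UNIV"
      unfolding g_def by (intro holomorphic_intros f holomorphic_cnj_cnj holomorphic_sinc_pi)
    then show "G holomorphic_on UNIV"
      unfolding G_def by (rule entire_compose) (intro holomorphic_intros)
    have "exp_type_at_most (pi + pi + (pi + pi)) g"
      unfolding g_def by (intro exp_type_at_most_mult exp_type_sinc_pi f exp_type_at_most_cnj)
    from exp_type_at_most_scale[OF this, of "1/2"] show "exp_type_at_most (2 * pi) G"
      by (simp add: G_def)
    show "integrable lborel (\<lambda>x. G (of_real x))"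
      unfolding G using iu2 by (rule integrable_of_real)
  qed
  moreover have "G (0 + of_int n) = of_real (u (of_int n / 2))" for n
    using G[of "of_int n"] by simp
  ultimately have all: "((\<lambda>n::int. u (of_int n / 2)) has_sum 2 * Q) UNIV"
    by (simp only: G integral_complex_of_real has_sum_of_real_iff LG)
  have "u (of_int n / 2) = 0" if n: "even n" "n \<noteq> 0" for n
  proof -
    from n(1) obtain m where m: "n = 2 * m" by blast
    then have "m \<noteq> 0" using n(2) by simp
    then show ?thesis using sinc_pi_int[of m] m by (simp add: u_def)
  qed
  then have ev: "((\<lambda>n::int. u (of_int n / 2)) has_sum u 0) {n. even n}"
    using has_sum_finite[of "{0::int}" "\<lambda>n. u 0"]
    by (subst has_sum_cong_neutral[where T = "{0}" and g = "\<lambda>_. u 0"]) auto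
  have "((\<lambda>n::int. u (of_int n / 2)) has_sum (2 * Q - u 0)) (UNIV - {n. even n})"
    by (rule has_sum_Diff[OF all ev]) auto
  moreover have "bij_betw (\<lambda>m::int. 2 * m + 1) UNIV (UNIV - {n. even n})"
    by (rule bij_betw_byWitness[where f' = "\<lambda>n. (n - 1) div 2"]) auto
  ultimately have "((\<lambda>m::int. u (of_int (2 * m + 1) / 2)) has_sum (2 * Q - u 0)) UNIV"
    by (subst has_sum_reindex_bij_betw)
  moreover have "of_int (2 * m + 1) / 2 = (1/2 + of_int m :: real)" for m by simp
  moreover have "u 0 = (cmod (f 0))\<^sup>2" by (simp add: u_def sinc_pi_def)
  ultimately show ?thesis by (simp only: Q_def u_def)
qed

section \<open>The equation for the parameter\<close>

text \<open>On (0, \<pi>/2) the equation x tan x = 1 is equivalent to x sin x = cos x. This form has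
  no pole, and its derivative 2 sin x + x cos x is positive.\<close>

lemma xsin_minus_cos_strict_mono:
  assumes "0 \<le> x" "x < y" "y \<le> pi / 2"
  shows "x * sin x - cos x < y * sin y - cos y"
proof (rule DERIV_pos_imp_increasing_open[OF assms(2)])
  fix t assume t: "x < t" "t < y"
  have "((\<lambda>t. t * sin t - cos t) has_real_derivative 2 * sin t + t * cos t) (at t)"
    by (auto intro!: derivative_eq_intros simp: algebra_simps)
  moreover have "sin t > 0" "cos t > 0" "t > 0"
    using t assms by (auto intro!: sin_gt_zero2 cos_gt_zero)
  then have "2 * sin t + t * cos t > 0" by (intro add_pos_pos mult_pos_pos) auto
  ultimately show "\<exists>D. ((\<lambda>t. t * sin t - cos t) has_real_derivative D) (at t) \<and> D > 0" by blast
qed (auto intro!: continuous_intros)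

section \<open>Numerical enclosure of the root\<close>

lemma Maclaurin_cos_bound: "\<bar>cos x - (\<Sum>m<n. cos_coeff m * x ^ m)\<bar> \<le> inverse (fact n) * \<bar>x\<bar> ^ n" for x :: real
proof -
  obtain t where t: "cos x = (\<Sum>m<n. cos_coeff m * x ^ m) + cos (t + 1 / 2 * real n * pi) / fact n * x ^ n"
    using Maclaurin_cos_expansion[of x n] by (elim exE conjE)
  define K where "K = cos (t + 1 / 2 * real n * pi)"
  have K: "\<bar>K\<bar> \<le> 1" unfolding K_def by (rule abs_cos_le_one)
  from t have "cos x - (\<Sum>m<n. cos_coeff m * x ^ m) = K * (inverse (fact n) * x ^ n)"
    unfolding K_def[symmetric] by (simp add: divide_inverse)
  then have "\<bar>cos x - (\<Sum>m<n. cos_coeff m * x ^ m)\<bar> = \<bar>K\<bar> * (inverse (fact n) * \<bar>x\<bar> ^ n)"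
    by (simp add: abs_mult power_abs)
  also have "\<dots> \<le> 1 * (inverse (fact n) * \<bar>x\<bar> ^ n)"
    using K by (intro mult_right_mono) auto
  finally show ?thesis by simp
qed

lemma sin_cos_taylor_sums:
  "(\<Sum>m<10. sin_coeff m * x ^ m) = x - x^3 / 6 + x^5 / 120 - x^7 / 5040 + x^9 / 362880"
  "(\<Sum>m<10. cos_coeff m * x ^ m) = 1 - x^2 / 2 + x^4 / 24 - x^6 / 720 + x^8 / 40320" for x :: real
proof -
  have "{..<10::nat} = {0,1,2,3,4,5,6,7,8,9}"
    by (intro set_eqI, simp, presburger)
  then show "(\<Sum>m<10. sin_coeff m * x ^ m) = x - x^3 / 6 + x^5 / 120 - x^7 / 5040 + x^9 / 362880"
    "(\<Sum>m<10. cos_coeff m * x ^ m) = 1 - x^2 / 2 + x^4 / 24 - x^6 / 720 + x^8 / 40320"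
    by (simp_all add: sin_coeff_def cos_coeff_def fact_numeral)
qed

lemma taylor_bounds:
  "\<bar>sin x - (x - x^3 / 6 + x^5 / 120 - x^7 / 5040 + x^9 / 362880)\<bar> \<le> \<bar>x\<bar> ^ 10 / 3628800"
  "\<bar>cos x - (1 - x^2 / 2 + x^4 / 24 - x^6 / 720 + x^8 / 40320)\<bar> \<le> \<bar>x\<bar> ^ 10 / 3628800" for x :: real
  using Maclaurin_sin_bound[of x 10] Maclaurin_cos_bound[of x 10]
  unfolding sin_cos_taylor_sums by (simp_all add: fact_numeral)

text \<open>The two points bracket the root 0.860333... of x tan x = 1. Each power is enclosed to
  eight decimals, which makes the Taylor estimates linear in known quantities. The remainder
  x^10/10! is below 10^-7, while the two values to be signed are of order 10^-5.\<close>

lemma xsin_minus_cos_bounds: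
  "(86033 / 100000) * sin (86033 / 100000) - cos ((86033 / 100000) :: real) < 0"
  "(86034 / 100000) * sin (86034 / 100000) - cos ((86034 / 100000) :: real) > 0"
proof -
  define x :: real where "x = 86033 / 100000"
  have x2: "(74016770 / 100000000) \<le> x ^ 2" "x ^ 2 \<le> (74016771 / 100000000)"
    unfolding x_def by (simp_all add: power_divide)
  have x3: "(63678848 / 100000000) \<le> x ^ 3" "x ^ 3 \<le> (63678849 / 100000000)"
    unfolding x_def by (simp_all add: power_divide)
  have x4: "(54784823 / 100000000) \<le> x ^ 4" "x ^ 4 \<le> (54784824 / 100000000)"
    unfolding x_def by (simp_all add: power_divide)
  have x5: "(47133027 / 100000000) \<le> x ^ 5" "x ^ 5 \<le> (47133028 / 100000000)"
    unfolding x_def by (simp_all add: power_divide)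
  have x6: "(40549957 / 100000000) \<le> x ^ 6" "x ^ 6 \<le> (40549958 / 100000000)"
    unfolding x_def by (simp_all add: power_divide)
  have x7: "(34886344 / 100000000) \<le> x ^ 7" "x ^ 7 \<le> (34886345 / 100000000)"
    unfolding x_def by (simp_all add: power_divide)
  have x8: "(30013769 / 100000000) \<le> x ^ 8" "x ^ 8 \<le> (30013770 / 100000000)"
    unfolding x_def by (simp_all add: power_divide)
  have x9: "(25821745 / 100000000) \<le> x ^ 9" "x ^ 9 \<le> (25821746 / 100000000)"
    unfolding x_def by (simp_all add: power_divide)
  have x10: "(22215222 / 100000000) \<le> x ^ 10" "x ^ 10 \<le> (22215223 / 100000000)"
    unfolding x_def by (simp_all add: power_divide)
  define y :: real where "y = (86034 / 100000)"
  have y2: "(74018491 / 100000000) \<le> y ^ 2" "y ^ 2 \<le> (74018492 / 100000000)"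
    unfolding y_def by (simp_all add: power_divide)
  have y3: "(63681069 / 100000000) \<le> y ^ 3" "y ^ 3 \<le> (63681070 / 100000000)"
    unfolding y_def by (simp_all add: power_divide)
  have y4: "(54787370 / 100000000) \<le> y ^ 4" "y ^ 4 \<le> (54787371 / 100000000)"
    unfolding y_def by (simp_all add: power_divide)
  have y5: "(47135766 / 100000000) \<le> y ^ 5" "y ^ 5 \<le> (47135767 / 100000000)"
    unfolding y_def by (simp_all add: power_divide)
  have y6: "(40552785 / 100000000) \<le> y ^ 6" "y ^ 6 \<le> (40552786 / 100000000)"
    unfolding y_def by (simp_all add: power_divide)
  have y7: "(34889183 / 100000000) \<le> y ^ 7" "y ^ 7 \<le> (34889184 / 100000000)"
    unfolding y_def by (simp_all add: power_divide)
  have y8: "(30016560 / 100000000) \<le> y ^ 8" "y ^ 8 \<le> (30016561 / 100000000)"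
    unfolding y_def by (simp_all add: power_divide)
  have y9: "(25824447 / 100000000) \<le> y ^ 9" "y ^ 9 \<le> (25824448 / 100000000)"
    unfolding y_def by (simp_all add: power_divide)
  have y10: "(22217805 / 100000000) \<le> y ^ 10" "y ^ 10 \<le> (22217806 / 100000000)"
    unfolding y_def by (simp_all add: power_divide)
  have abx: "\<bar>x\<bar> = x" by (simp add: x_def)
  have sx: "sin x \<le> (758059 / 1000000)"
    using taylor_bounds(1)[of x] x_def x3 x5 x7 x9 x10
    unfolding abx abs_le_iff by linarith
  have cx: "(652187 / 1000000) \<le> cos x"
    using taylor_bounds(2)[of x] x2 x4 x6 x8 x10
    unfolding abx abs_le_iff by linarith
  have aby: "\<bar>y\<bar> = y" by (simp add: y_def)
  have sy: "(758064 / 1000000) \<le> sin y"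
    using taylor_bounds(1)[of y] y_def y3 y5 y7 y9 y10
    unfolding aby abs_le_iff by linarith
  have cy: "cos y \<le> (65218 / 100000)"
    using taylor_bounds(2)[of y] y2 y4 y6 y8 y10
    unfolding aby abs_le_iff by linarith
  show "(86033 / 100000) * sin (86033 / 100000) - cos ((86033 / 100000) :: real) < 0" using sx cx unfolding x_def by simp
  show "(86034 / 100000) * sin (86034 / 100000) - cos ((86034 / 100000) :: real) > 0" using sy cy unfolding y_def by simp
qed

text \<open>Dividing the bracket for \<pi>\<theta> by \<pi> lands inside the required five-digit
  interval for \<theta>; the last bound keeps the bracket in the range of monotonicity.\<close>

lemma pi_mult_bounds: "(27385 / 100000) * pi \<le> (86033 / 100000)" "(86034 / 100000) < (27386 / 100000) * pi" "(86034 / 100000) < pi / 2"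
  using pi_approx by simp_all

lemma mult_tan_eq_1_iff:
  assumes "0 < \<theta>" "\<theta> < 1 / 2"
  shows "(pi * \<theta>) * tan (pi * \<theta>) = 1 \<longleftrightarrow> (pi * \<theta>) * sin (pi * \<theta>) - cos (pi * \<theta>) = 0"
proof -
  have "cos (pi * \<theta>) > 0" using assms by (intro cos_gt_zero) auto
  then show ?thesis by (auto simp: tan_def field_simps)
qed

lemma ex1_theta: "\<exists>!\<theta>::real. 0 < \<theta> \<and> \<theta> < 1/2 \<and> (pi * \<theta>) * tan (pi * \<theta>) = 1"
proof -
  define F where "F = (\<lambda>x::real. x * sin x - cos x)"
  have "\<exists>x\<ge>(86033 / 100000). x \<le> (86034 / 100000) \<and> F x = 0"
    by (rule IVT') (use xsin_minus_cos_bounds in \<open>auto simp: F_def intro!: continuous_intros\<close>)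
  then obtain x where x: "(86033 / 100000) \<le> x" "x \<le> (86034 / 100000)" "F x = 0" by blast
  show ?thesis
  proof (rule ex1I[of _ "x / pi"])
    have "0 < x / pi" "x / pi < 1 / 2"
      using x pi_mult_bounds(3) by (auto simp: field_simps)
    moreover have "pi * (x / pi) = x" by simp
    ultimately show "0 < x / pi \<and> x / pi < 1/2 \<and> (pi * (x / pi)) * tan (pi * (x / pi)) = 1"
      using x(3) by (subst mult_tan_eq_1_iff) (auto simp: F_def)
    fix \<theta> :: real assume \<theta>: "0 < \<theta> \<and> \<theta> < 1/2 \<and> (pi * \<theta>) * tan (pi * \<theta>) = 1"
    then have F\<theta>: "F (pi * \<theta>) = 0" using mult_tan_eq_1_iff[of \<theta>] by (simp add: F_def)
    have r: "0 < pi * \<theta>" "pi * \<theta> < pi / 2" using \<theta> by auto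
    have "pi * \<theta> = x"
      using xsin_minus_cos_strict_mono[of "pi * \<theta>" x] xsin_minus_cos_strict_mono[of x "pi * \<theta>"]
        x F\<theta> r pi_mult_bounds(3) by (cases "pi * \<theta>" x rule: linorder_cases) (auto simp: F_def)
    then show "\<theta> = x / pi" by (simp add: field_simps)
  qed
qed

lemma theta_bounds:
  assumes "0 < \<theta>" "\<theta> < 1/2" "(pi * \<theta>) * tan (pi * \<theta>) = 1"
  shows "(86033 / 100000) < pi * \<theta>" "pi * \<theta> < (86034 / 100000)"
proof -
  have F: "(pi * \<theta>) * sin (pi * \<theta>) - cos (pi * \<theta>) = 0" using assms mult_tan_eq_1_iff by blast
  have r: "0 < pi * \<theta>" "pi * \<theta> < pi / 2" using assms by auto
  show "(86033 / 100000) < pi * \<theta>"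
    using xsin_minus_cos_strict_mono[of "pi * \<theta>" "(86033 / 100000)"] xsin_minus_cos_bounds F r pi_mult_bounds
    by (cases "pi * \<theta>" "(86033 / 100000)::real" rule: linorder_cases) auto
  show "pi * \<theta> < (86034 / 100000)"
    using xsin_minus_cos_strict_mono[of "(86034 / 100000)" "pi * \<theta>"] xsin_minus_cos_bounds F r pi_mult_bounds
    by (cases "pi * \<theta>" "(86034 / 100000)::real" rule: linorder_cases) auto
qed

lemma theta_numerics:
  assumes "0 < \<theta>" "\<theta> < 1/2" "(pi * \<theta>) * tan (pi * \<theta>) = 1"
  shows "0.27385 \<le> \<theta>" "\<theta> < 0.27386" "0.3244 \<le> 1 - 1 / (2 * pi\<^sup>2 * \<theta>\<^sup>2)" "1 - 1 / (2 * pi\<^sup>2 * \<theta>\<^sup>2) < 0.3245"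
proof -
  note b = theta_bounds[OF assms]
  have "(27385 / 100000) \<le> \<theta>"
  proof (rule ccontr)
    assume "\<not> (27385 / 100000) \<le> \<theta>"
    then have "pi * \<theta> < pi * (27385 / 100000)" by simp
    then show False using b pi_mult_bounds by linarith
  qed
  then show "0.27385 \<le> \<theta>" by simp
  have "\<theta> < (27386 / 100000)"
  proof (rule ccontr)
    assume "\<not> \<theta> < (27386 / 100000)"
    then have "pi * (27386 / 100000) \<le> pi * \<theta>" by simp
    then show False using b pi_mult_bounds by linarith
  qed
  then show "\<theta> < 0.27386" by simp
  have lo: "(86033 / 100000)\<^sup>2 \<le> (pi * \<theta>)\<^sup>2" and hi: "(pi * \<theta>)\<^sup>2 \<le> (86034 / 100000)\<^sup>2"
    using b by (intro power_mono; simp)+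
  have eq: "2 * pi\<^sup>2 * \<theta>\<^sup>2 = 2 * (pi * \<theta>)\<^sup>2" by (simp add: power_mult_distrib)
  have pos: "(pi * \<theta>)\<^sup>2 > 0" using assms by simp
  show "0.3244 \<le> 1 - 1 / (2 * pi\<^sup>2 * \<theta>\<^sup>2)" "1 - 1 / (2 * pi\<^sup>2 * \<theta>\<^sup>2) < 0.3245"
    unfolding eq using lo hi pos by (simp_all add: field_simps power2_eq_square)
qed

section \<open>The extremal problem\<close>

lemma has_sum_diff:
  fixes f g :: "'a \<Rightarrow> real"
  assumes "(f has_sum a) A" "(g has_sum b) A"
  shows "((\<lambda>x. f x - g x) has_sum (a - b)) A"
  using has_sum_add[OF assms(1) has_sum_uminusI[OF assms(2)]] by simp

locale extremal_parameter =
  fixes \<theta> :: real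
  assumes \<theta>_pos: "0 < \<theta>" and \<theta>_less: "\<theta> < 1/2" and \<theta>_eq: "(pi * \<theta>) * tan (pi * \<theta>) = 1"
begin

definition m :: "int \<Rightarrow> real" where "m n = 1/2 + of_int n"
definition b :: "int \<Rightarrow> real" where "b n = sinc_pi (m n)"
text \<open>The gap \<lambda> - b_n^2, where \<lambda> = 1/(\<pi>\<theta>)^2 is the claimed top
  eigenvalue of the form 2 Q in the half-integer samples.\<close>

definition w :: "int \<Rightarrow> real" where "w n = 1 / (pi\<^sup>2 * \<theta>\<^sup>2) - (b n)\<^sup>2"
text \<open>The eigenvector: b_n^2 v_n + b_n <v, b> = \<lambda> v_n means that v_n is proportional
  to b_n / (\<lambda> - b_n^2). The normalization is <v, b> = 1, which is the secular
  equation.\<close>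

definition v :: "int \<Rightarrow> real" where "v n = b n / w n"
definition \<kappa> :: real where "\<kappa> = 2 * cos (pi * \<theta>) / (pi\<^sup>2 * \<theta>\<^sup>2)"
definition E :: "complex \<Rightarrow> complex" where "E z = sinc_pi (z + of_real \<theta>) + sinc_pi (z - of_real \<theta>)"

lemma cos_pos: "cos (pi * \<theta>) > 0"
  using \<theta>_pos \<theta>_less by (intro cos_gt_zero) auto

lemma \<kappa>_pos: "\<kappa> > 0"
  using cos_pos \<theta>_pos by (simp add: \<kappa>_def)

text \<open>A half-integer has modulus at least 1/2, hence above \<theta>. Through
  \<open>w_eq\<close> this says that \<lambda> exceeds every b_n^2, so the weights of the deficit
  are positive.\<close>

lemma m_sq: "\<theta>\<^sup>2 < (m n)\<^sup>2"
proof -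
  have "\<theta> < \<bar>m n\<bar>"
  proof (cases "n \<ge> 0")
    case True
    then show ?thesis using \<theta>_less by (simp add: m_def)
  next
    case False
    then have "of_int n \<le> (-1 :: real)" by simp
    then show ?thesis using \<theta>_less by (simp add: m_def)
  qed
  then have "\<theta>\<^sup>2 < \<bar>m n\<bar>\<^sup>2" using \<theta>_pos by (intro power_strict_mono) auto
  then show ?thesis by simp
qed

lemma m_nz: "m n \<noteq> 0" "m n + \<theta> \<noteq> 0" "m n - \<theta> \<noteq> 0"
  using m_sq[of n] by (auto simp: add_eq_0_iff2)

lemma cos_m: "cos (pi * m n) = 0"
  by (simp add: m_def distrib_left cos_add)

lemma sin_m_sq: "(sin (pi * m n))\<^sup>2 = 1"
  using sin_cos_squared_add[of "pi * m n"] by (simp add: cos_m)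

lemma b_eq: "b n = sin (pi * m n) / (pi * m n)"
  using m_nz by (simp add: b_def sinc_pi_def)

lemma w_eq: "w n = ((m n)\<^sup>2 - \<theta>\<^sup>2) / (pi\<^sup>2 * \<theta>\<^sup>2 * (m n)\<^sup>2)"
  using \<theta>_pos m_nz[of n] by (simp add: w_def b_eq power_divide power_mult_distrib sin_m_sq field_simps)

lemma w_pos: "w n > 0"
  using m_sq[of n] m_nz[of n] \<theta>_pos by (simp add: w_eq)

lemma v_mult_w: "v n * w n = b n"
  using w_pos[of n] by (simp add: v_def)

lemma v_eq: "v n = pi * \<theta>\<^sup>2 * m n * sin (pi * m n) / ((m n)\<^sup>2 - \<theta>\<^sup>2)"
  using m_sq[of n] m_nz[of n] \<theta>_pos
  by (simp add: v_def b_eq w_eq field_simps power2_eq_square)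

text \<open>As cos (\<pi> m) = 0 at a half-integer m, both shifted sincs have the numerator sin
  (\<pi> m) cos (\<pi> \<theta>). Adding the simple fractions with denominators m + \<theta> and m -
  \<theta> produces m / (m^2 - \<theta>^2), the shape of \<open>v\<close>. This is the origin of the
  two shifts in \<open>E\<close>.\<close>

lemma E_sample: "E (of_real (m n)) = of_real (\<kappa> * v n)"
proof -
  have "sinc_pi (m n + \<theta>) + sinc_pi (m n - \<theta>)
      = sin (pi * m n) * cos (pi * \<theta>) / (pi * (m n + \<theta>)) + sin (pi * m n) * cos (pi * \<theta>) / (pi * (m n - \<theta>))"
    using m_nz by (simp add: sinc_pi_def distrib_left right_diff_distrib sin_add sin_diff cos_m)
  also have "\<dots> = sin (pi * m n) * cos (pi * \<theta>) / pi * (1 / (m n + \<theta>) + 1 / (m n - \<theta>))"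
    by (simp add: distrib_left)
  also have "1 / (m n + \<theta>) + 1 / (m n - \<theta>) = 2 * m n / ((m n)\<^sup>2 - \<theta>\<^sup>2)"
    using m_nz m_sq[of n] by (simp add: field_simps power2_eq_square)
  also have "sin (pi * m n) * cos (pi * \<theta>) / pi * (2 * m n / ((m n)\<^sup>2 - \<theta>\<^sup>2)) = \<kappa> * v n"
    using \<theta>_pos by (simp add: \<kappa>_def v_eq power2_eq_square)
  finally have "complex_of_real (sinc_pi (m n + \<theta>) + sinc_pi (m n - \<theta>)) = of_real (\<kappa> * v n)" by simp
  then show ?thesis
    unfolding E_def using sinc_pi_of_real[of "m n + \<theta>"] sinc_pi_of_real[of "m n - \<theta>"] by simp
qed

text \<open>Here the equation for \<theta> enters: sin (\<pi>\<theta>) / (\<pi>\<theta>) = cos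
  (\<pi>\<theta>) / (\<pi>\<theta>)^2 is another form of it. It makes the value at 0 carry the same
  factor \<kappa> as the samples.\<close>

lemma E_0: "E 0 = of_real \<kappa>"
proof -
  have "pi * \<theta> * sin (pi * \<theta>) = cos (pi * \<theta>)"
    using \<theta>_eq cos_pos by (simp add: tan_def field_simps)
  then have "2 * sinc_pi \<theta> = \<kappa>"
    using \<theta>_pos by (simp add: sinc_pi_def \<kappa>_def power2_eq_square field_simps)
  moreover have "sinc_pi (- \<theta>) = sinc_pi \<theta>" by (simp add: sinc_pi_def)
  ultimately have "complex_of_real (sinc_pi \<theta> + sinc_pi (- \<theta>)) = of_real \<kappa>" by simp
  then show ?thesis
    unfolding E_def using sinc_pi_of_real[of \<theta>] sinc_pi_of_real[of "- \<theta>"] by simp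
qed

lemma E_paley_wiener: "E \<in> paley_wiener pi"
proof -
  have "(\<lambda>z. sinc_pi (z + of_real \<theta>) + sinc_pi (z + of_real (- \<theta>))) \<in> paley_wiener pi"
    by (intro paley_wiener_add paley_wiener_shift sinc_pi_in_paley_wiener) simp_all
  then show ?thesis by (simp add: E_def[abs_def])
qed

text \<open>The secular equation, the sum of b_n^2 / (\<lambda> - b_n^2) being 1. It is the identity
  for f(0) applied to \<open>E\<close>, divided by the common factor \<kappa>.\<close>

lemma has_sum_v_b: "((\<lambda>n. v n * b n) has_sum 1) UNIV"
proof -
  have "((\<lambda>n::int. E (of_real (m n)) * of_real (b n)) has_sum E 0) UNIV"
    using has_sum_samples_sinc[OF E_paley_wiener] by (simp only: m_def b_def)
  then have "((\<lambda>n::int. of_real (\<kappa> * (v n * b n)) :: complex) has_sum of_real \<kappa>) UNIV"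
    by (simp add: E_sample E_0 mult.assoc)
  then have "((\<lambda>n::int. \<kappa> * (v n * b n)) has_sum \<kappa>) UNIV"
    by (simp only: has_sum_of_real_iff)
  then have "((\<lambda>n::int. (1 / \<kappa>) * (\<kappa> * (v n * b n))) has_sum (1 / \<kappa>) * \<kappa>) UNIV"
    by (rule has_sum_cmult_right)
  then show ?thesis using \<kappa>_pos by simp
qed

definition N :: "(complex \<Rightarrow> complex) \<Rightarrow> real" where
  "N f = (LINT x|lborel. (cmod (f (of_real x)))\<^sup>2)"
definition Q :: "(complex \<Rightarrow> complex) \<Rightarrow> real" where
  "Q f = (LINT x|lborel. (cmod (f (of_real x)))\<^sup>2 * (sinc_pi x)\<^sup>2)"

text \<open>In terms of the samples at the half-integers, the form \<open>2 Q\<close> is a rank-one perturbation of a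
  diagonal form; completing the square with respect to its top eigenvector \<open>v\<close> gives the deficit.\<close>

lemma has_sum_deficit:
  assumes f: "f \<in> paley_wiener pi"
  shows "((\<lambda>n. w n * (cmod (f (of_real (m n)) - f 0 * of_real (v n)))\<^sup>2) has_sum
    (N f / (pi\<^sup>2 * \<theta>\<^sup>2) - 2 * Q f)) UNIV"
proof -
  define a where "a = (\<lambda>n. f (of_real (m n)))"
  have 1: "((\<lambda>n. 1 / (pi\<^sup>2 * \<theta>\<^sup>2) * (cmod (a n))\<^sup>2) has_sum 1 / (pi\<^sup>2 * \<theta>\<^sup>2) * N f) UNIV"
    using has_sum_norm_sq_samples[OF f, of "1/2"] by (intro has_sum_cmult_right) (simp only: a_def m_def N_def)
  have 2: "((\<lambda>n. (cmod (a n))\<^sup>2 * (b n)\<^sup>2) has_sum (2 * Q f - (cmod (f 0))\<^sup>2)) UNIV"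
    using has_sum_weighted_samples[OF f] by (simp only: a_def m_def b_def Q_def)
  have "((\<lambda>n. a n * of_real (b n)) has_sum f 0) UNIV"
    using has_sum_samples_sinc[OF f] by (simp only: a_def m_def b_def)
  \<comment> \<open>Pairing the series for f(0) with its own conjugate value gives the cross term of
    the square; it sums to |f(0)|^2.\<close>
  then have "((\<lambda>n. Re (cnj (f 0) * (a n * of_real (b n)))) has_sum Re (cnj (f 0) * f 0)) UNIV"
    by (intro has_sum_Re has_sum_cmult_right)
  then have 3: "((\<lambda>n. 2 * Re (cnj (f 0) * (a n * of_real (b n)))) has_sum 2 * Re (cnj (f 0) * f 0)) UNIV"
    by (rule has_sum_cmult_right)
  have 4: "((\<lambda>n. (cmod (f 0))\<^sup>2 * (v n * b n)) has_sum (cmod (f 0))\<^sup>2 * 1) UNIV"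
    by (intro has_sum_cmult_right has_sum_v_b)
  have "((\<lambda>n. (1 / (pi\<^sup>2 * \<theta>\<^sup>2) * (cmod (a n))\<^sup>2 - (cmod (a n))\<^sup>2 * (b n)\<^sup>2
        - 2 * Re (cnj (f 0) * (a n * of_real (b n)))) + (cmod (f 0))\<^sup>2 * (v n * b n)) has_sum
      (1 / (pi\<^sup>2 * \<theta>\<^sup>2) * N f - (2 * Q f - (cmod (f 0))\<^sup>2) - 2 * Re (cnj (f 0) * f 0)) + (cmod (f 0))\<^sup>2 * 1) UNIV"
    by (intro has_sum_add has_sum_diff 1 2 3 4)
  moreover have "(1 / (pi\<^sup>2 * \<theta>\<^sup>2) * (cmod (a n))\<^sup>2 - (cmod (a n))\<^sup>2 * (b n)\<^sup>2
        - 2 * Re (cnj (f 0) * (a n * of_real (b n)))) + (cmod (f 0))\<^sup>2 * (v n * b n)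
      = w n * (cmod (a n - f 0 * of_real (v n)))\<^sup>2" for n
  proof -
    have sq: "(cmod (a n - f 0 * of_real (v n)))\<^sup>2
        = (cmod (a n))\<^sup>2 - 2 * v n * Re (cnj (f 0) * a n) + (cmod (f 0))\<^sup>2 * (v n)\<^sup>2"
      unfolding cmod_power2 by (simp add: power2_eq_square algebra_simps)
    have "w n * (cmod (a n - f 0 * of_real (v n)))\<^sup>2
        = w n * (cmod (a n))\<^sup>2 - 2 * (v n * w n) * Re (cnj (f 0) * a n) + (cmod (f 0))\<^sup>2 * (v n * (v n * w n))"
      unfolding sq by (simp add: algebra_simps power2_eq_square)
    also have "\<dots> = w n * (cmod (a n))\<^sup>2 - 2 * b n * Re (cnj (f 0) * a n) + (cmod (f 0))\<^sup>2 * (v n * b n)"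
      by (simp only: v_mult_w)
    finally show ?thesis by (simp add: w_def algebra_simps)
  qed
  moreover have "(1 / (pi\<^sup>2 * \<theta>\<^sup>2) * N f - (2 * Q f - (cmod (f 0))\<^sup>2) - 2 * Re (cnj (f 0) * f 0)) + (cmod (f 0))\<^sup>2 * 1
      = N f / (pi\<^sup>2 * \<theta>\<^sup>2) - 2 * Q f"
  proof -
    have "Re (cnj (f 0) * f 0) = (cmod (f 0))\<^sup>2"
      unfolding cmod_power2 by (simp add: power2_eq_square)
    then show ?thesis by (simp only:) simp
  qed
  ultimately show ?thesis by (simp only: a_def)
qed

lemma Q_le: "f \<in> paley_wiener pi \<Longrightarrow> 2 * Q f \<le> N f / (pi\<^sup>2 * \<theta>\<^sup>2)"
proof -
  assume "f \<in> paley_wiener pi"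
  from has_sum_nonneg[OF has_sum_deficit[OF this]]
  have "0 \<le> N f / (pi\<^sup>2 * \<theta>\<^sup>2) - 2 * Q f" by (simp add: w_pos less_imp_le)
  then show ?thesis by simp
qed

text \<open>Equality makes a sum of nonnegative terms vanish, and the positive weights force every
  sample to be f(0) v_n. Hence f and a multiple of \<open>E\<close> agree on the half-integers, and
  the norm identity on that single lattice makes their difference zero. Conversely every term of the
  deficit of a multiple of \<open>E\<close> is zero.\<close>

lemma Q_eq_iff:
  assumes f: "f \<in> paley_wiener pi"
  shows "2 * Q f = N f / (pi\<^sup>2 * \<theta>\<^sup>2) \<longleftrightarrow> (\<exists>c. f = (\<lambda>z. c * E z))"
proof
  assume eq: "2 * Q f = N f / (pi\<^sup>2 * \<theta>\<^sup>2)"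
  define c where "c = f 0 / of_real \<kappa>"
  have sample: "f (of_real (m n)) = c * E (of_real (m n))" for n
  proof -
    have "w n * (cmod (f (of_real (m n)) - f 0 * of_real (v n)))\<^sup>2 = 0"
      by (rule nonneg_has_sum_le_0D[OF has_sum_deficit[OF f]]) (auto simp: eq w_pos less_imp_le)
    then have "f (of_real (m n)) = f 0 * of_real (v n)"
      using w_pos[of n] by simp
    then show ?thesis using \<kappa>_pos by (simp add: c_def E_sample)
  qed
  define d where "d = (\<lambda>z. f z + (- c) * E z)"
  have d: "d \<in> paley_wiener pi"
    unfolding d_def by (intro paley_wiener_add paley_wiener_cmult f E_paley_wiener)
  have "(\<lambda>n::int. (cmod (d (of_real (1/2 + of_int n))))\<^sup>2) = (\<lambda>n. 0)"
    using sample by (simp add: d_def m_def)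
  then have "((\<lambda>n::int. 0) has_sum (LINT x|lborel. (cmod (d (of_real x)))\<^sup>2)) UNIV"
    using has_sum_norm_sq_samples[OF d, of "1/2"] by simp
  then have "(LINT x|lborel. (cmod (d (of_real x)))\<^sup>2) = 0"
    by (rule has_sum_unique[OF _ has_sum_0_simp])
  then have d0: "d = (\<lambda>z. 0)" by (rule paley_wiener_eq_0[OF d])
  have "f z = c * E z" for z using fun_cong[OF d0, of z] by (simp add: d_def)
  then show "\<exists>c. f = (\<lambda>z. c * E z)" by blast
next
  assume "\<exists>c. f = (\<lambda>z. c * E z)"
  then obtain c where c: "f = (\<lambda>z. c * E z)" by blast
  have "f (of_real (m n)) - f 0 * of_real (v n) = 0" for n
    by (simp add: c E_sample E_0)
  then have "((\<lambda>n::int. 0) has_sum (N f / (pi\<^sup>2 * \<theta>\<^sup>2) - 2 * Q f)) UNIV"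
    using has_sum_deficit[OF f] by simp
  then have "N f / (pi\<^sup>2 * \<theta>\<^sup>2) - 2 * Q f = 0"
    by (rule has_sum_unique[OF _ has_sum_0_simp])
  then show "2 * Q f = N f / (pi\<^sup>2 * \<theta>\<^sup>2)" by simp
qed

section \<open>From the quadratic forms back to the norms and the infimum\<close>

lemma N_nonneg: "N f \<ge> 0"
  unfolding N_def by simp

lemma N_pos:
  assumes "f \<in> paley_wiener pi" "f \<noteq> (\<lambda>z. 0)"
  shows "N f > 0"
proof -
  have "N f \<noteq> 0" using paley_wiener_eq_0[OF assms(1)] assms(2) by (auto simp: N_def)
  then show ?thesis using N_nonneg[of f] by simp
qed

lemma L2_norm_lborel: "L2_norm_real_line lborel f = sqrt (N f)"
  by (simp add: L2_norm_real_line_def N_def)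

lemma L2_norm_pair_corr:
  assumes f: "f \<in> paley_wiener pi"
  shows "L2_norm_real_line pair_corr_measure f = sqrt (N f - Q f)"
proof -
  have m1: "(\<lambda>x::real. 1 - (sinc_pi x)\<^sup>2) \<in> borel_measurable lborel"
  proof -
    have "continuous_on UNIV (\<lambda>x::real. 1 - (sinc_pi x)\<^sup>2)" by (intro continuous_intros continuous_sinc_pi)
    then show ?thesis by (simp add: borel_measurable_continuous_onI)
  qed
  have m2: "(\<lambda>x::real. (cmod (f (of_real x)))\<^sup>2) \<in> borel_measurable lborel"
    using paley_wienerD(3)[OF f] by (rule borel_measurable_integrable)
  have "(LINT x|pair_corr_measure. (cmod (f (of_real x)))\<^sup>2)
      = (LINT x|lborel. (1 - (sinc_pi x)\<^sup>2) *\<^sub>R (cmod (f (of_real x)))\<^sup>2)"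
    unfolding pair_corr_measure_def
    by (rule integral_density[OF m2 m1]) (simp add: sinc_pi_sq_le_1)
  also have "\<dots> = (LINT x|lborel. (cmod (f (of_real x)))\<^sup>2 - (cmod (f (of_real x)))\<^sup>2 * (sinc_pi x)\<^sup>2)"
    by (simp add: algebra_simps)
  also have "\<dots> = N f - Q f"
    unfolding N_def Q_def
    by (rule Bochner_Integration.integral_diff[OF paley_wienerD(3)[OF f] integrable_sinc_weighted[OF f]])
  finally show ?thesis by (simp add: L2_norm_real_line_def)
qed

text \<open>Guarantees that the root in the weighted norm has a nonnegative argument, so that
  squaring the norm returns \<open>N f - Q f\<close>.\<close>

lemma Q_le_N:
  assumes f: "f \<in> paley_wiener pi"
  shows "Q f \<le> N f"
  unfolding N_def Q_def
  by (rule integral_mono[OF integrable_sinc_weighted[OF f] paley_wienerD(3)[OF f]])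
     (simp add: mult_left_le sinc_pi_sq_le_1)

lemma ratio_ge:
  assumes f: "f \<in> paley_wiener pi" "f \<noteq> (\<lambda>z. 0)"
  shows "1 - 1 / (2 * pi\<^sup>2 * \<theta>\<^sup>2) \<le> (N f - Q f) / N f"
  using Q_le[OF f(1)] N_pos[OF f] \<theta>_pos by (simp add: field_simps)

lemma ratio_eq_iff:
  assumes f: "f \<in> paley_wiener pi" "f \<noteq> (\<lambda>z. 0)"
  shows "(N f - Q f) / N f = 1 - 1 / (2 * pi\<^sup>2 * \<theta>\<^sup>2) \<longleftrightarrow> (\<exists>c. f = (\<lambda>z. c * E z))"
  unfolding Q_eq_iff[OF f(1), symmetric] using N_pos[OF f] \<theta>_pos by (auto simp: field_simps)

lemma multiple_E_nonzero:
  assumes "c \<noteq> 0"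
  shows "(\<lambda>z. c * E z) \<in> paley_wiener pi" "(\<lambda>z. c * E z) \<noteq> (\<lambda>z. 0)"
proof -
  show "(\<lambda>z. c * E z) \<in> paley_wiener pi" by (intro paley_wiener_cmult E_paley_wiener)
  have "c * E 0 \<noteq> 0" using assms \<kappa>_pos by (simp add: E_0)
  then show "(\<lambda>z. c * E z) \<noteq> (\<lambda>z. 0)" by metis
qed

lemma D_sq_eq: "D_sq = 1 - 1 / (2 * pi\<^sup>2 * \<theta>\<^sup>2)"
proof -
  have ratio: "(L2_norm_real_line pair_corr_measure f)\<^sup>2 / (L2_norm_real_line lborel f)\<^sup>2 = (N f - Q f) / N f"
    if "f \<in> paley_wiener pi" for f
    using that Q_le_N[OF that] N_nonneg[of f] by (simp add: L2_norm_pair_corr L2_norm_lborel)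
  have E: "E \<in> paley_wiener pi" "E \<noteq> (\<lambda>z. 0)" using multiple_E_nonzero[of 1] by auto
  have "\<exists>c. E = (\<lambda>z. c * E z)" by (rule exI[of _ 1]) simp
  then have "(N E - Q E) / N E = 1 - 1 / (2 * pi\<^sup>2 * \<theta>\<^sup>2)" using ratio_eq_iff[OF E] by blast
  then show ?thesis
    unfolding D_sq_def using E ratio_ge
    by (intro cInf_eq_minimum) (auto simp: ratio intro!: image_eqI[of _ _ E])
qed

lemma extremals:
  "{f \<in> paley_wiener pi. f \<noteq> (\<lambda>z. 0) \<and>
      L2_norm_real_line pair_corr_measure f / L2_norm_real_line lborel f = sqrt D_sq}
   = {\<lambda>z. c * E z | c. c \<noteq> 0}"
proof -
  have iff: "L2_norm_real_line pair_corr_measure f / L2_norm_real_line lborel f = sqrt D_sq \<longleftrightarrow> (\<exists>c. f = (\<lambda>z. c * E z))"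
    if "f \<in> paley_wiener pi" "f \<noteq> (\<lambda>z. 0)" for f
    using that ratio_eq_iff[OF that]
    by (simp add: L2_norm_pair_corr L2_norm_lborel D_sq_eq flip: real_sqrt_divide)
  show ?thesis
  proof (intro set_eqI iffI)
    fix f assume "f \<in> {f \<in> paley_wiener pi. f \<noteq> (\<lambda>z. 0) \<and>
      L2_norm_real_line pair_corr_measure f / L2_norm_real_line lborel f = sqrt D_sq}"
    then obtain c where "f = (\<lambda>z. c * E z)" "f \<noteq> (\<lambda>z. 0)" using iff by auto
    then have "c \<noteq> 0" by auto
    then show "f \<in> {\<lambda>z. c * E z | c. c \<noteq> 0}" using \<open>f = (\<lambda>z. c * E z)\<close> by blast
  next
    fix f assume "f \<in> {\<lambda>z. c * E z | c. c \<noteq> 0}"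
    then obtain c where "c \<noteq> 0" "f = (\<lambda>z. c * E z)" by blast
    then show "f \<in> {f \<in> paley_wiener pi. f \<noteq> (\<lambda>z. 0) \<and>
      L2_norm_real_line pair_corr_measure f / L2_norm_real_line lborel f = sqrt D_sq}"
      using multiple_E_nonzero[of c] iff[of f] by auto
  qed
qed

end

theorem theorem19:
  shows "(\<exists>!\<theta>::real. 0 < \<theta> \<and> \<theta> < 1/2 \<and> (pi * \<theta>) * tan (pi * \<theta>) = 1) \<and>
    (\<forall>\<theta>::real. 0 < \<theta> \<and> \<theta> < 1/2 \<and> (pi * \<theta>) * tan (pi * \<theta>) = 1 \<longrightarrow>
       0.27385 \<le> \<theta> \<and> \<theta> < 0.27386 \<and>
       D_sq = 1 - 1 / (2 * pi\<^sup>2 * \<theta>\<^sup>2) \<and>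
       0.3244 \<le> D_sq \<and> D_sq < 0.3245 \<and>
       {f \<in> paley_wiener pi. f \<noteq> (\<lambda>z. 0) \<and>
          L2_norm_real_line pair_corr_measure f / L2_norm_real_line lborel f = sqrt D_sq} =
       {(\<lambda>z. c * (sinc_pi (z + of_real \<theta>) + sinc_pi (z - of_real \<theta>))) | c::complex. c \<noteq> 0})"
proof (rule conjI[OF ex1_theta], intro allI impI)
  fix \<theta> :: real assume \<theta>: "0 < \<theta> \<and> \<theta> < 1/2 \<and> (pi * \<theta>) * tan (pi * \<theta>) = 1"
  then interpret extremal_parameter \<theta> by unfold_locales auto
  show "0.27385 \<le> \<theta> \<and> \<theta> < 0.27386 \<and>
       D_sq = 1 - 1 / (2 * pi\<^sup>2 * \<theta>\<^sup>2) \<and>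
       0.3244 \<le> D_sq \<and> D_sq < 0.3245 \<and>
       {f \<in> paley_wiener pi. f \<noteq> (\<lambda>z. 0) \<and>
          L2_norm_real_line pair_corr_measure f / L2_norm_real_line lborel f = sqrt D_sq} =
       {(\<lambda>z. c * (sinc_pi (z + of_real \<theta>) + sinc_pi (z - of_real \<theta>))) | c::complex. c \<noteq> 0}"
    using theta_numerics[OF \<theta>_pos \<theta>_less \<theta>_eq] extremals unfolding E_def D_sq_eq by (intro conjI refl)
qed

end
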